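(* Let $F$ be a finite field of characteristic $p$ and order $q$ with $[F:\mathbb{F}_p]=2^s$ for some $s\ge1$. Let $d$ be a positive integer with $\gcd(d,q-1)=1$ such that $d$ is not degenerate over $F$ but is degenerate over $\mathbb{F}_p$. Then $V_{F,d}\le\frac12[F:\mathbb{F}_p]$, and this is an equality whenever $d$ is degenerate over the subfield of $F$ of order $\sqrt q$.
   Context: $\psi$ is the canonical additive character of $F$, $\psi(x)=e^{2\pi i\operatorname{Tr}(x)/p}$ with $\operatorname{Tr}$ the absolute trace $F\to\mathbb{F}_p$. For $a\in F$, $W_{F,d}(a)=\sum_{x\in F}\psi(x^d-ax)$, and $V_{F,d}=\min_{a\in F}\operatorname{val}_p(W_{F,d}(a))$, where $\operatorname{val}_p$ is the $p$-adic valuation extended to $\mathbb{Q}(e^{2\pi i/p})$ with $\operatorname{val}_p(1-e^{2\pi i/p})=1/(p-1)$ (so $\operatorname{val}_p(p)=1$). For a subfield $K$ of $F$, $d$ is degenerate over $K$ if $d$ is congruent to a power of $p$ modulo $|K|-1$. *)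

theory Defs
  imports
    "HOL-Algebra.Algebraic_Closure_Type"
    "HOL-Computational_Algebra.Computational_Algebra"
    "HOL-Number_Theory.Cong"
    "HOL-Library.Extended_Real"
    "HOL-Analysis.Analysis"
begin

definition prime_subfield :: "'a::finite_field set" where
  "prime_subfield = range of_nat"

definition abs_degree :: "'a::finite_field itself \<Rightarrow> nat" where
  "abs_degree _ = ring.dim (ring_of_type_algebra :: 'a ring) prime_subfield UNIV"

definition abs_trace :: "'a::finite_field \<Rightarrow> 'a" where
  "abs_trace x = (\<Sum>i<abs_degree TYPE('a). x ^ (CHAR('a) ^ i))"

text \<open>The trace lies in the prime subfield; \<open>nat_rep\<close> is its least nonnegative integer
  representative, so that it can be used in the exponent of a complex exponential.\<close>

definition nat_rep :: "'a::finite_field \<Rightarrow> nat" where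
  "nat_rep y = (THE k. k < CHAR('a) \<and> of_nat k = y)"

definition canonical_char :: "'a::finite_field \<Rightarrow> complex" where
  "canonical_char x = exp (2 * of_real pi * \<i> * of_nat (nat_rep (abs_trace x)) / of_nat CHAR('a))"

definition weil_sum :: "nat \<Rightarrow> 'a::finite_field \<Rightarrow> complex" where
  "weil_sum d a = (\<Sum>x\<in>UNIV. canonical_char (x ^ d - a * x))"

definition zeta :: "nat \<Rightarrow> complex" where
  "zeta p = exp (2 * of_real pi * \<i> / of_nat p)"

definition cyclotomic_ints :: "nat \<Rightarrow> complex set" where
  "cyclotomic_ints p = range (\<lambda>f :: int poly. poly (map_poly of_int f) (zeta p))"

definition prime_elem_multiples :: "nat \<Rightarrow> complex set" where
  "prime_elem_multiples p = (\<lambda>z. (1 - zeta p) * z) ` cyclotomic_ints p"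

text \<open>For prime \<open>p\<close> the element \<open>1 - \<zeta>\<close> generates the unique prime ideal of \<open>\<int>[\<zeta>]\<close> above \<open>p\<close>,
  and \<open>p\<close> is a unit times \<open>(1 - \<zeta>) ^ (p - 1)\<close>. The extension of the \<open>p\<close>-adic valuation to
  \<open>\<rat>(\<zeta>)\<close> is therefore the \<open>(1 - \<zeta>)\<close>-adic valuation divided by \<open>p - 1\<close>. Every nonzero element of
  \<open>\<rat>(\<zeta>)\<close> is \<open>(1 - \<zeta>)\<^sup>k a / b\<close> for a unique integer \<open>k\<close>, with \<open>a\<close>, \<open>b\<close> in \<open>\<int>[\<zeta>]\<close> not divisible
  by \<open>1 - \<zeta>\<close>. The value is unspecified outside \<open>\<rat>(\<zeta>)\<close>.\<close>

definition val :: "nat \<Rightarrow> complex \<Rightarrow> ereal" where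
  "val p x =
     (if x = 0 then \<infinity>
      else ereal (real_of_int
        (THE k. \<exists>a \<in> cyclotomic_ints p - prime_elem_multiples p.
                \<exists>b \<in> cyclotomic_ints p - prime_elem_multiples p.
                  x = (1 - zeta p) powi k * a / b) / real (p - 1)))"

definition min_val :: "'a::finite_field itself \<Rightarrow> nat \<Rightarrow> ereal" where
  "min_val _ d = Min (range (\<lambda>a::'a. val CHAR('a) (weil_sum d a)))"

definition degenerate_over :: "nat \<Rightarrow> 'a::finite_field set \<Rightarrow> bool" where
  "degenerate_over d K \<longleftrightarrow> (\<exists>k::nat. [d = CHAR('a) ^ k] (mod (card K - 1)))"

end

theory Submission
  imports Defs "Jordan_Normal_Form.Char_Poly"
begin

text \<open>
  Degeneracy over the prime field makes all Weil sums rational integers. Climb the tower of quadratic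
  extensions from the prime field to \<open>F\<close>, and let \<open>K \<subset> L\<close> be the step at which \<open>d\<close> stops being
  degenerate, with \<open>|K| = Q\<close>. There \<open>d\<close> is a Niho exponent: \<open>W\<^sub>L(a) = Q u(a)\<close> with integers \<open>u(a) \<ge> -1\<close>.
  If \<open>p\<close> divided every \<open>u(a)\<close>, all \<open>W\<^sub>L(a)\<close> would be nonnegative, and the moments \<open>\<Sum> W = q\<close> and
  \<open>\<Sum> W\<^sup>2 = q\<^sup>2\<close> would leave only one nonzero value \<open>W\<^sub>L(a) = q\<close>, which makes \<open>d\<close> degenerate over \<open>L\<close>.

  For a further quadratic extension \<open>E \<subset> E'\<close> the Hasse--Davenport relation says that the push-forward
  of \<open>W\<^sub>E\<^sub>'\<close> along the norm is the multiplicative convolution of \<open>W\<^sub>E\<close> with itself. Its quadratic case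
  follows from a count: for each trace and norm, the conjugate pairs in \<open>E'\<close> and the pairs in \<open>E\<close>
  together number two. Since the group ring of \<open>E\<^sup>*\<close> over the field with \<open>p\<close> elements is reduced,
  divisibility by \<open>p\<close> passes from the convolution square of an integer-valued function on \<open>E\<^sup>*\<close> to the
  function itself, so the minimal valuation at most doubles at every step.
\<close>

section \<open>Subfields of a finite field\<close>

text \<open>Every field of the tower is a subset of the one type \<open>'a\<close>, so no field
  types have to be built. The set has \<open>CHAR('a) ^ k\<close> elements when \<open>k\<close>
  divides the degree; later lemmas carry this as a hypothesis on \<open>card\<close>. For
  \<open>k = 0\<close> it is the whole type.\<close>

definition frob_fixed :: "nat \<Rightarrow> 'a::finite_field set" where
  "frob_fixed k = {x. x ^ (CHAR('a) ^ k) = x}"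

text \<open>The absolute trace of the subfield with \<open>CHAR('a) ^ k\<close> elements; the trace
  between neighbouring levels of the tower is \<open>quad_trace\<close>.\<close>

definition rel_trace :: "nat \<Rightarrow> 'a::finite_field \<Rightarrow> 'a" where
  "rel_trace k x = (\<Sum>i<k. x ^ (CHAR('a) ^ i))"

lemma frob_add: "(x + y :: 'a::finite_field) ^ (CHAR('a) ^ k) = x ^ (CHAR('a) ^ k) + y ^ (CHAR('a) ^ k)"
  by (rule freshmans_dream') auto

lemma frob_uminus: "(- x :: 'a::finite_field) ^ (CHAR('a) ^ k) = - (x ^ (CHAR('a) ^ k))"
  using frob_add[of x "-x" k] by (simp add: power_0_left eq_neg_iff_add_eq_0 add.commute)

lemma frob_diff: "(x - y :: 'a::finite_field) ^ (CHAR('a) ^ k) = x ^ (CHAR('a) ^ k) - y ^ (CHAR('a) ^ k)"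
  using frob_add[of x "-y" k] by (simp add: frob_uminus)

lemma CHAR_ge_2: "CHAR('a::finite_field) \<ge> 2"
  by (simp add: prime_ge_2_nat)

lemma CHAR_power_gt_1: "k > 0 \<Longrightarrow> 1 < CHAR('a::finite_field) ^ k"
  using CHAR_ge_2[where 'a='a] by (intro one_less_power) auto

lemma frob_fixed_0 [simp]: "0 \<in> frob_fixed k"
  by (simp add: frob_fixed_def power_0_left)
lemma frob_fixed_1 [simp]: "1 \<in> frob_fixed k"
  by (simp add: frob_fixed_def)
lemma frob_fixed_add [simp]: "x \<in> frob_fixed k \<Longrightarrow> y \<in> frob_fixed k \<Longrightarrow> x + y \<in> frob_fixed k"
  by (simp add: frob_fixed_def frob_add)
lemma frob_fixed_diff [simp]: "x \<in> frob_fixed k \<Longrightarrow> y \<in> frob_fixed k \<Longrightarrow> x - y \<in> frob_fixed k"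
  by (simp add: frob_fixed_def frob_diff)
lemma frob_fixed_uminus [simp]: "- x \<in> frob_fixed k \<longleftrightarrow> x \<in> frob_fixed k"
  by (simp add: frob_fixed_def frob_uminus)
lemma frob_fixed_mult [simp]: "x \<in> frob_fixed k \<Longrightarrow> y \<in> frob_fixed k \<Longrightarrow> x * y \<in> frob_fixed k"
  by (simp add: frob_fixed_def power_mult_distrib)
lemma frob_fixed_divide [simp]: "x \<in> frob_fixed k \<Longrightarrow> y \<in> frob_fixed k \<Longrightarrow> x / y \<in> frob_fixed k"
  by (simp add: frob_fixed_def power_divide)
lemma frob_fixed_power [simp]: "x \<in> frob_fixed k \<Longrightarrow> x ^ n \<in> frob_fixed k"
  by (induction n) auto
lemma frob_fixed_of_nat [simp]: "of_nat n \<in> frob_fixed k"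
  by (induction n) auto

lemma frob_fixed_mult_right:
  assumes "x \<in> frob_fixed k"
  shows "x \<in> frob_fixed (k * m)"
proof (induction m)
  case (Suc m)
  have "x ^ (CHAR('a) ^ (k * Suc m)) = (x ^ (CHAR('a) ^ (k * m))) ^ (CHAR('a) ^ k)"
    by (simp add: power_mult [symmetric] power_add [symmetric] add.commute)
  then show ?case using Suc assms by (simp add: frob_fixed_def)
qed (simp add: frob_fixed_def)

lemma frob_fixed_double: "x \<in> frob_fixed k \<Longrightarrow> x \<in> frob_fixed (2 * k)"
  using frob_fixed_mult_right[of x k 2] by (simp add: mult.commute)

text \<open>All root counts below are brought to this form, \<open>x ^ n\<close> on one side and a
  polynomial of lower degree on the other: Frobenius fixed points, norms, kernels of traces,
  quadratic equations.\<close>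

lemma card_power_roots_le:
  fixes f :: "'a::idom poly"
  assumes "degree f < n"
  shows "card {x. x ^ n = poly f x} \<le> n"
proof -
  let ?g = "monom 1 n - f"
  have deg: "degree ?g = n"
    using degree_add_eq_left[of "-f" "monom 1 n"] assms by (simp add: degree_monom_eq)
  have "?g \<noteq> 0"
    using deg assms by force
  then have "card {x. poly ?g x = 0} \<le> degree ?g"
    by (rule card_poly_roots_bound)
  then show ?thesis
    using deg by (simp add: poly_monom)
qed

lemma card_frob_fixed_le:
  assumes "k > 0"
  shows "card (frob_fixed k :: 'a::finite_field set) \<le> CHAR('a) ^ k"
proof -
  show ?thesis
    using CHAR_power_gt_1[OF assms, where 'a='a] card_power_roots_le[of "[:0, 1::'a:]" "CHAR('a) ^ k"] by (simp add: frob_fixed_def)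
qed

lemma inj_on_of_nat_CHAR: "inj_on (of_nat :: nat \<Rightarrow> 'a::finite_field) {..<CHAR('a)}"
  by (auto simp: inj_on_def of_nat_eq_iff_cong_CHAR cong_less_modulus_unique_nat)

text \<open>The residues of \<open>0, ..., p - 1\<close> are \<open>p\<close> fixed points of
  Frobenius, and there is no room for more.\<close>

lemma frob_fixed_1_eq: "frob_fixed 1 = (of_nat ` {..<CHAR('a)} :: 'a::finite_field set)"
proof -
  have "(of_nat ` {..<CHAR('a)} :: 'a set) = frob_fixed 1"
  proof (rule card_seteq)
    show "card (frob_fixed 1 :: 'a set) \<le> card (of_nat ` {..<CHAR('a)} :: 'a set)"
      using card_frob_fixed_le[of 1, where 'a='a]
      by (simp add: card_image[OF inj_on_of_nat_CHAR])
  qed auto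
  then show ?thesis ..
qed

lemma prime_subfield_eq: "prime_subfield = frob_fixed 1"
proof -
  have "of_nat n \<in> (of_nat ` {..<CHAR('a)} :: 'a set)" for n
    by (rule image_eqI[of _ _ "n mod CHAR('a)"]) (auto simp: of_nat_eq_iff_cong_CHAR cong_def)
  then show ?thesis
    unfolding frob_fixed_1_eq prime_subfield_def by auto
qed

lemma card_frob_fixed_1: "card (frob_fixed 1 :: 'a::finite_field set) = CHAR('a)"
  by (simp add: frob_fixed_1_eq card_image[OF inj_on_of_nat_CHAR] del: One_nat_def)

lemma nat_rep:
  assumes "y \<in> frob_fixed 1"
  shows "nat_rep y < CHAR('a::finite_field)" "of_nat (nat_rep y) = (y::'a)"
proof -
  obtain k where k: "k < CHAR('a)" "of_nat k = y"
    using assms unfolding frob_fixed_1_eq by auto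
  have "nat_rep y < CHAR('a) \<and> of_nat (nat_rep y) = y"
    unfolding nat_rep_def
    by (rule theI[of _ k]) (use k in \<open>auto simp: of_nat_eq_iff_cong_CHAR cong_less_modulus_unique_nat\<close>)
  then show "nat_rep y < CHAR('a)" "of_nat (nat_rep y) = y" by auto
qed

lemma frob_fixed_power_card_minus_1:
  assumes "x \<in> frob_fixed k" "x \<noteq> 0"
  shows "x ^ (CHAR('a::finite_field) ^ k - 1) = (1::'a)"
proof -
  have "x * x ^ (CHAR('a) ^ k - 1) = x ^ (CHAR('a) ^ k)"
    by (simp flip: power_Suc)
  then show ?thesis
    using assms by (simp add: frob_fixed_def)
qed

text \<open>Exponents matter only modulo the order of the multiplicative group. Positivity of both
  exponents admits \<open>x = 0\<close>, where \<open>0 ^ 0 = 1\<close> would break the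
  rule.\<close>

lemma frob_fixed_power_cong:
  assumes "x \<in> frob_fixed k" "[m = n] (mod (CHAR('a::finite_field) ^ k - 1))" "m > 0" "n > 0"
  shows "x ^ m = (x::'a) ^ n"
proof (cases "x = 0")
  case False
  have "x ^ m = x ^ n" if mn: "m \<le> n" "[m = n] (mod (CHAR('a) ^ k - 1))" for m n
  proof -
    obtain q where "n = m + q * (CHAR('a) ^ k - 1)"
      using cong_le_nat[OF mn(1)] cong_sym[OF mn(2)] by (auto simp: add.commute)
    then show ?thesis
      using frob_fixed_power_card_minus_1[OF assms(1) False] by (simp add: power_add power_mult mult.commute[of q])
  qed
  then show ?thesis
    using assms(2) cong_sym[OF assms(2)] nat_le_linear[of m n] by (elim disjE) (auto dest: sym)
qed (use assms in \<open>simp add: power_0_left\<close>)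

text \<open>The norm \<open>x \<mapsto> x ^ (Q + 1)\<close> maps \<open>q - 1 = (Q - 1) (Q + 1)\<close> elements to \<open>frob_fixed k - {0}\<close>
  with fibres of size at most \<open>Q + 1\<close>.\<close>
lemma card_frob_fixed_half:
  assumes "k > 0" and card: "card (frob_fixed (2 * k) :: 'a::finite_field set) = CHAR('a) ^ (2 * k)"
  shows "card (frob_fixed k :: 'a set) = CHAR('a) ^ k"
proof -
  define Q where "Q = CHAR('a) ^ k"
  have Q1: "Q > 1"
    unfolding Q_def using assms(1) by (rule CHAR_power_gt_1)
  have Q2: "CHAR('a) ^ (2 * k) = Q * Q"
    by (simp add: Q_def power_add mult_2)
  let ?K = "frob_fixed k :: 'a set" and ?L = "frob_fixed (2 * k) :: 'a set"
  have "(Q - 1) * (Q + 1) = card (?L - {0})"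
    using Q1 card Q2 by (simp add: algebra_simps)
  also have "?L - {0} \<subseteq> (\<Union>c\<in>?K - {0}. {x. x ^ (Q + 1) = poly [:c:] x})"
  proof
    fix x assume x: "x \<in> ?L - {0}"
    have "(x ^ (Q + 1)) ^ Q = x ^ (Q * Q) * x ^ Q"
      by (simp add: power_mult [symmetric] power_add [symmetric] algebra_simps)
    also have "x ^ (Q * Q) = x"
      using x by (simp add: frob_fixed_def Q2)
    finally have "x ^ (Q + 1) \<in> ?K"
      by (simp add: frob_fixed_def flip: Q_def)
    then show "x \<in> (\<Union>c\<in>?K - {0}. {x. x ^ (Q + 1) = poly [:c:] x})"
      using x by auto
  qed
  then have "card (?L - {0}) \<le> card (\<Union>c\<in>?K - {0}. {x. x ^ (Q + 1) = poly [:c:] x})"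
    by (intro card_mono) auto
  also have "\<dots> \<le> (\<Sum>c\<in>?K - {0}. card {x. x ^ (Q + 1) = poly [:c:] x})"
    by (intro card_UN_le) auto
  also have "\<dots> \<le> (\<Sum>c\<in>?K - {0}. Q + 1)"
    by (intro sum_mono card_power_roots_le) auto
  also have "\<dots> = card (?K - {0}) * (Q + 1)"
    by simp
  finally have "Q - 1 \<le> card (?K - {0})"
    by (simp only: mult_le_cancel2)
  moreover have "card ?K > 0"
    using frob_fixed_0[of k, where 'a='a] by (metis card_gt_0_iff empty_iff finite)
  ultimately have "Q \<le> card ?K"
    by (simp add: card_Diff_singleton_if)
  then show ?thesis
    using card_frob_fixed_le[of k, where 'a='a] assms(1) unfolding Q_def by simp
qed

section \<open>The degree over the prime field and the order of the field\<close>

lemma subfield_prime_subfield: "subfield (prime_subfield :: 'a::finite_field set) ring_of_type_algebra"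
proof -
  interpret field "ring_of_type_algebra :: 'a ring"
    by (rule field_from_type_algebra)
  show ?thesis
  proof (rule subfieldI', rule subringI)
    fix x y :: 'a assume "x \<in> prime_subfield" "y \<in> prime_subfield"
    then show "x \<otimes>\<^bsub>ring_of_type_algebra\<^esub> y \<in> prime_subfield" "x \<oplus>\<^bsub>ring_of_type_algebra\<^esub> y \<in> prime_subfield"
      by (simp_all only: prime_subfield_eq) (simp_all add: ring_of_type_algebra_def del: One_nat_def)
  next
    fix x :: 'a assume "x \<in> prime_subfield"
    then have "- x \<in> prime_subfield" by (simp only: prime_subfield_eq frob_fixed_uminus)
    moreover have "\<ominus>\<^bsub>ring_of_type_algebra\<^esub> x = - x"
      by (rule minus_equality) (auto simp: ring_of_type_algebra_def)
    ultimately show "\<ominus>\<^bsub>ring_of_type_algebra\<^esub> x \<in> prime_subfield" by simp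
  next
    fix x :: 'a assume x: "x \<in> prime_subfield - {\<zero>\<^bsub>ring_of_type_algebra\<^esub>}"
    then have "1 / x \<in> prime_subfield" 
      unfolding prime_subfield_eq by (intro frob_fixed_divide) auto
    moreover have "inv\<^bsub>ring_of_type_algebra\<^esub> x = 1 / x"
      by (rule comm_inv_char) (use x in \<open>auto simp: ring_of_type_algebra_def\<close>)
    ultimately show "inv\<^bsub>ring_of_type_algebra\<^esub> x \<in> prime_subfield" by simp
  qed (auto simp: ring_of_type_algebra_def prime_subfield_def intro: range_eqI[of _ _ 1])
qed

lemma line_extension_type_algebra:
  "ring.line_extension ring_of_type_algebra K v E = {c * v + e | c e. c \<in> K \<and> e \<in> (E :: 'a::field set)}"
  unfolding ring.line_extension_def[OF ring_from_type_algebra] r_coset_def set_add_def set_mult_def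
  by (auto simp: ring_of_type_algebra_def)

text \<open>Each step of the inductive construction of a dimension adjoins a vector \<open>v\<close>
  outside \<open>E\<close>. The pairs \<open>(c, e)\<close> then give distinct sums
  \<open>c * v + e\<close>, so the size is multiplied by \<open>p\<close>.\<close>

lemma card_dimension:
  assumes "ring.dimension (ring_of_type_algebra :: 'a::finite_field ring) n prime_subfield E"
  shows "card E = CHAR('a) ^ n"
proof -
  interpret ring "ring_of_type_algebra :: 'a ring"
    by (rule ring_from_type_algebra)
  \<comment> \<open>Closure of \<open>E\<close> under sums and scalars is carried along, as
    injectivity needs it. \<open>K\<close> is a variable here so that the rule induction
    applies.\<close>
  have "card E = CHAR('a) ^ n \<and> 0 \<in> E \<and> (\<forall>x\<in>E. \<forall>y\<in>E. x + y \<in> E) \<and> (\<forall>c\<in>K. \<forall>x\<in>E. c * x \<in> E)"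
    if "dimension n K E" "K = prime_subfield" for n K E
    using that
  proof (induction rule: dimension.induct)
    case (zero_dim K)
    then show ?case by (simp add: ring_of_type_algebra_def)
  next
    case (Suc_dim v E n K)
    then have E: "card E = CHAR('a) ^ n" "0 \<in> E" "\<And>x y. x \<in> E \<Longrightarrow> y \<in> E \<Longrightarrow> x + y \<in> E"
      "\<And>c x. c \<in> K \<Longrightarrow> x \<in> E \<Longrightarrow> c * x \<in> E" and v: "v \<notin> E"
      by auto
    have K: "K = frob_fixed 1"
      using Suc_dim.prems prime_subfield_eq by simp
    let ?f = "\<lambda>(c, e). c * v + e"
    have eq: "line_extension K v E = ?f ` (K \<times> E)"
      unfolding line_extension_type_algebra by auto
    have "inj_on ?f (K \<times> E)"
    proof (rule inj_onI, clarify)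
      fix c e c' e' assume *: "c \<in> K" "e \<in> E" "c' \<in> K" "e' \<in> E" "c * v + e = c' * v + e'"
      have "c = c'"
      proof (rule ccontr)
        assume "c \<noteq> c'"
        \<comment> \<open>With different coefficients the equation can be solved for
          \<open>v\<close>, which places it in \<open>E\<close>.\<close>
        then have "v = (1 / (c - c')) * (e' + (- 1) * e)"
          using *(5) by (simp add: field_simps)
        moreover have "1 / (c - c') \<in> K" "- 1 \<in> K"
          using * unfolding K by (simp_all del: One_nat_def)
        ultimately have "v \<in> E"
          using E(3,4) *(2,4) by metis
        then show False using v by simp
      qed
      then show "c = c' \<and> e = e'"
        using * by simp
    qed
    then have "card (line_extension K v E) = CHAR('a) ^ Suc n"
      unfolding eq using card_frob_fixed_1[where 'a='a] E(1)
      by (simp add: card_image card_cartesian_product K del: One_nat_def)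
    moreover have "0 \<in> line_extension K v E"
      unfolding eq using E(2) K by (intro image_eqI[of _ _ "(0, 0)"]) (auto simp del: One_nat_def)
    moreover have "x + y \<in> line_extension K v E"
      if xy: "x \<in> line_extension K v E" "y \<in> line_extension K v E" for x y
    proof -
      obtain c e c' e' where *: "x = c * v + e" "y = c' * v + e'" "c \<in> K" "c' \<in> K" "e \<in> E" "e' \<in> E"
        using xy unfolding line_extension_type_algebra by blast
      then show ?thesis
        unfolding eq using E(3) K
        by (intro image_eqI[of _ _ "(c + c', e + e')"]) (auto simp: algebra_simps simp del: One_nat_def)
    qed
    moreover have "a * x \<in> line_extension K v E" if ax: "a \<in> K" "x \<in> line_extension K v E" for a x
    proof -
      obtain c e where *: "x = c * v + e" "c \<in> K" "e \<in> E"
        using ax unfolding eq by auto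
      then show ?thesis
        unfolding eq using E(4) K ax(1)
        by (intro image_eqI[of _ _ "(a * c, a * e)"]) (auto simp: algebra_simps simp del: One_nat_def)
    qed
    ultimately show ?case by blast
  qed
  then show ?thesis using assms by blast
qed

text \<open>The list of all elements spans the field over the prime field, which makes the dimension
  finite and the previous count applicable.\<close>

lemma CARD_eq_CHAR_power: "CARD('a::finite_field) = CHAR('a) ^ abs_degree TYPE('a)"
proof -
  interpret ring "ring_of_type_algebra :: 'a ring"
    by (rule ring_from_type_algebra)
  note K = subfield_prime_subfield[where 'a='a]
  obtain xs :: "'a list" where xs: "set xs = UNIV"
    using finite_list[OF finite[of UNIV]] by auto
  have carrier: "carrier (ring_of_type_algebra :: 'a ring) = UNIV"
    by (simp add: ring_of_type_algebra_def)
  have "Span prime_subfield xs = UNIV"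
    using Span_base_incl[OF K, of xs] xs carrier by auto
  then have "finite_dimension prime_subfield UNIV"
    using Span_finite_dimension[OF K, of xs] carrier by simp
  then have "dimension (abs_degree TYPE('a)) prime_subfield UNIV"
    using finite_dimensionE[OF K] unfolding abs_degree_def over_def by simp
  then show ?thesis
    by (rule card_dimension)
qed

lemma frob_fixed_abs_degree: "frob_fixed (abs_degree TYPE('a)) = (UNIV :: 'a::finite_field set)"
  by (simp add: frob_fixed_def finite_field_power_card_eq_same flip: CARD_eq_CHAR_power)


section \<open>The valuation on rational integers\<close>

lemma zeta_power: "zeta p ^ n = exp (2 * of_real pi * \<i> * of_nat n / of_nat p)"
  by (simp add: zeta_def mult_ac flip: exp_of_nat_mult)

lemma zeta_power_eq_1_iff: "p > 0 \<Longrightarrow> zeta p ^ n = 1 \<longleftrightarrow> p dvd n"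
  unfolding zeta_power using complex_root_unity_eq_1[of p n] by simp

lemma zeta_power_mod:
  assumes "p > 0"
  shows "zeta p ^ (n mod p) = zeta p ^ n"
proof -
  have "zeta p ^ n = zeta p ^ (p * (n div p) + n mod p)"
    by simp
  also have "\<dots> = zeta p ^ (n mod p)"
    using zeta_power_eq_1_iff[OF assms, of "p * (n div p)"] by (simp only: power_add) simp
  finally show ?thesis ..
qed

lemma norm_zeta [simp]: "norm (zeta p) = 1"
  by (simp add: zeta_def norm_exp_eq_Re)

text \<open>Multiplication by \<open>f(\<zeta>)\<close> acts on the powers of \<open>\<zeta>\<close> by an integral (circulant) matrix.\<close>
lemma algebraic_int_cyclotomic_ints:
  assumes "p > 0" "w \<in> cyclotomic_ints p"
  shows "algebraic_int w"
proof -
  obtain f :: "int poly" where w: "w = poly (map_poly of_int f) (zeta p)"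
    using assms(2) unfolding cyclotomic_ints_def by blast
  define A :: "int mat" where
    "A = Matrix.mat p p (\<lambda>(i, j). \<Sum>l\<in>{l. l \<le> degree f \<and> (i + l) mod p = j}. coeff f l)"
  have A: "A \<in> carrier_mat p p"
    by (simp add: A_def)
  define B :: "complex mat" where "B = map_mat of_int A"
  have B: "B \<in> carrier_mat p p"
    using A by (simp add: B_def)
  define v where "v = Matrix.vec p (\<lambda>i. zeta p ^ i)"
  have "eigenvector B v w"
    unfolding eigenvector_def
  proof (intro conjI)
    show "v \<in> carrier_vec (dim_row B)"
      using B by (simp add: v_def)
    have "vec_index v 0 = 1"
      using assms(1) by (simp add: v_def)
    then show "v \<noteq> 0\<^sub>v (dim_row B)"
      using B assms(1) by auto
    show "B *\<^sub>v v = w \<cdot>\<^sub>v v"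
    proof (rule eq_vecI)
      fix i assume "i < dim_vec (w \<cdot>\<^sub>v v)"
      then have i: "i < p" by (simp add: v_def)
      have "vec_index (B *\<^sub>v v) i = (\<Sum>j<p. (\<Sum>l\<in>{l. l \<le> degree f \<and> (i + l) mod p = j}. of_int (coeff f l)) * zeta p ^ j)"
        using i A by (simp add: B_def v_def scalar_prod_def A_def lessThan_atLeast0)
      also have "\<dots> = (\<Sum>j<p. \<Sum>l\<in>{l\<in>{..degree f}. (i + l) mod p = j}. of_int (coeff f l) * zeta p ^ (i + l))"
      proof (rule sum.cong[OF refl])
        fix j
        have "of_int (coeff f l) * zeta p ^ j = of_int (coeff f l) * zeta p ^ (i + l)"
          if "(i + l) mod p = j" for l
          using that zeta_power_mod[OF assms(1), of "i + l"] by simp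
        then show "(\<Sum>l\<in>{l. l \<le> degree f \<and> (i + l) mod p = j}. of_int (coeff f l)) * zeta p ^ j =
          (\<Sum>l\<in>{l\<in>{..degree f}. (i + l) mod p = j}. of_int (coeff f l) * zeta p ^ (i + l))"
          by (auto simp: sum_distrib_right intro!: sum.cong)
      qed
      also have "\<dots> = (\<Sum>l\<le>degree f. of_int (coeff f l) * zeta p ^ (i + l))"
        by (rule sum.group) (use assms(1) in auto)
      also have "\<dots> = w * zeta p ^ i"
        by (simp add: w poly_altdef power_add sum_distrib_left mult_ac)
      finally show "vec_index (B *\<^sub>v v) i = vec_index (w \<cdot>\<^sub>v v) i"
        using i by (simp add: v_def)
    qed (use B in \<open>simp add: v_def\<close>)
  qed
  then have "poly (char_poly B) w = 0"
    using eigenvalue_root_char_poly[OF B] by (auto simp: eigenvalue_def)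
  also have "char_poly B = map_poly of_int (char_poly A)"
    unfolding B_def by (rule of_int_hom.char_poly_hom[OF A])
  finally have "poly (map_poly of_int (char_poly A)) w = 0" .
  moreover have "lead_coeff (char_poly A) = 1"
    using degree_monic_char_poly[OF A] by simp
  ultimately show ?thesis
    unfolding algebraic_int_altdef_ipoly by blast
qed

text \<open>A rational algebraic integer is an integer, and \<open>1 / p\<close> is none. This is
  what later keeps \<open>1 - zeta p\<close> from being a unit.\<close>

lemma inverse_prime_notin_cyclotomic_ints:
  assumes "prime p" "w \<in> cyclotomic_ints p"
  shows "of_nat p * w \<noteq> 1"
proof
  assume *: "of_nat p * w = 1"
  then have w: "w = 1 / of_nat p"
    using assms(1) by (simp add: field_simps)
  have "algebraic_int w"
    using assms prime_gt_0_nat by (intro algebraic_int_cyclotomic_ints) auto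
  moreover have "w \<in> \<rat>"
    by (simp add: w)
  ultimately have "w \<in> \<int>"
    by (rule rational_algebraic_int_is_int)
  then obtain m where m: "w = of_int m"
    by (elim Ints_cases)
  have "(of_int (int p * m) :: complex) = of_int 1"
    using * m by simp
  then have "int p * m = 1"
    by (simp only: of_int_eq_iff)
  then show False
    using assms(1) by (metis int_ops(2) not_prime_1 of_nat_eq_iff pos_zmult_eq_1_iff prime_gt_0_nat of_nat_0_less_iff)
qed

section \<open>The ring generated by \<open>zeta p\<close> and its prime element
  \<open>1 - zeta p\<close>\<close>

lemma cyclotomic_intsE:
  assumes "x \<in> cyclotomic_ints p"
  obtains f :: "int poly" where "x = poly (map_poly of_int f) (zeta p)"
  using assms by (auto simp: cyclotomic_ints_def)

lemma cyclotomic_intsI: "poly (map_poly of_int f) (zeta p) \<in> cyclotomic_ints p"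
  by (auto simp: cyclotomic_ints_def)

lemma cyclotomic_ints_add: "x \<in> cyclotomic_ints p \<Longrightarrow> y \<in> cyclotomic_ints p \<Longrightarrow> x + y \<in> cyclotomic_ints p"
  by (elim cyclotomic_intsE) (metis cyclotomic_intsI of_int_poly_hom.hom_add poly_add)

lemma cyclotomic_ints_mult: "x \<in> cyclotomic_ints p \<Longrightarrow> y \<in> cyclotomic_ints p \<Longrightarrow> x * y \<in> cyclotomic_ints p"
  by (elim cyclotomic_intsE) (metis cyclotomic_intsI of_int_poly_hom.hom_mult poly_mult)

lemma cyclotomic_ints_of_int: "of_int n \<in> cyclotomic_ints p"
  using cyclotomic_intsI[of "[:n:]" p] by (simp only: of_int_hom.map_poly_pCons_hom) simp

lemma cyclotomic_ints_one_minus_zeta: "1 - zeta p \<in> cyclotomic_ints p"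
  using cyclotomic_intsI[of "[:1, -1:]" p] by simp

lemma cyclotomic_ints_uminus: "x \<in> cyclotomic_ints p \<Longrightarrow> - x \<in> cyclotomic_ints p"
  using cyclotomic_ints_mult[OF cyclotomic_ints_of_int[of "-1"]] by simp

lemma cyclotomic_ints_power: "x \<in> cyclotomic_ints p \<Longrightarrow> x ^ n \<in> cyclotomic_ints p"
  using cyclotomic_ints_of_int[of 1 p] by (induction n) (auto simp: cyclotomic_ints_mult)

lemma cyclotomic_ints_sum: "(\<And>i. i \<in> I \<Longrightarrow> f i \<in> cyclotomic_ints p) \<Longrightarrow> sum f I \<in> cyclotomic_ints p"
  using cyclotomic_ints_of_int[of 0 p] by (induction I rule: infinite_finite_induct) (auto simp: cyclotomic_ints_add)

lemma prime_elem_multiplesI: "z \<in> cyclotomic_ints p \<Longrightarrow> (1 - zeta p) * z \<in> prime_elem_multiples p"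
  by (auto simp: prime_elem_multiples_def)

lemma prime_elem_multiples_add:
  "x \<in> prime_elem_multiples p \<Longrightarrow> y \<in> prime_elem_multiples p \<Longrightarrow> x + y \<in> prime_elem_multiples p"
  by (auto simp: prime_elem_multiples_def simp flip: distrib_left intro!: imageI cyclotomic_ints_add)

lemma prime_elem_multiples_mult:
  "x \<in> cyclotomic_ints p \<Longrightarrow> y \<in> prime_elem_multiples p \<Longrightarrow> x * y \<in> prime_elem_multiples p"
  by (auto simp: prime_elem_multiples_def mult.left_commute[of x] intro!: imageI cyclotomic_ints_mult)

text \<open>Expand \<open>(1 - \<pi>)\<^sup>p = 1\<close> with \<open>\<pi> = 1 - \<zeta>\<close>.\<close>
lemma prime_eq_one_minus_zeta_power:
  assumes p: "prime p"
  obtains z where "z \<in> cyclotomic_ints p" "of_nat p * (1 - (1 - zeta p) * z) = (- 1) ^ p * (1 - zeta p) ^ (p - 1)"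
proof -
  define x where "x = zeta p - 1"
  have p2: "p \<ge> 2"
    using p by (rule prime_ge_2_nat)
  have zp: "zeta p ^ p = 1"
    using zeta_power_eq_1_iff[of p p] p2 by simp
  have "zeta p ^ 1 \<noteq> 1"
    using zeta_power_eq_1_iff[of p 1] p2 by auto
  then have x0: "x \<noteq> 0"
    by (simp add: x_def)
  define c where "c i = (p choose i) div p" for i
  have c: "p choose i = p * c i" if "0 < i" "i < p" for i
    using dvd_choose_prime[of i p] that p by (simp add: c_def)
  \<comment> \<open>The binomial coefficients strictly between the ends are multiples of
    \<open>p\<close>; the terms of degree at least 2 are collected in \<open>z\<close>.\<close>
  define z where "z = (\<Sum>i\<in>{2..<p}. of_nat (c i) * x ^ (i - 2))"
  have "1 = (x + 1) ^ p"
    by (simp add: x_def zp)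
  also have "\<dots> = (\<Sum>i\<le>p. of_nat (p choose i) * x ^ i)"
    by (simp add: binomial_ring)
  also have "{..p} = insert 0 (insert 1 (insert p {2..<p}))"
    using p2 by auto
  also have "(\<Sum>i\<in>\<dots>. of_nat (p choose i) * x ^ i) = 1 + of_nat p * x + (\<Sum>i\<in>{2..<p}. of_nat (p choose i) * x ^ i) + x ^ p"
    using p2 by simp
  also have "(\<Sum>i\<in>{2..<p}. of_nat (p choose i) * x ^ i) = of_nat p * x ^ 2 * z"
    unfolding z_def sum_distrib_left
  proof (intro sum.cong refl)
    fix i assume i: "i \<in> {2..<p}"
    then have "x ^ i = x ^ 2 * x ^ (i - 2)"
      by (metis atLeastLessThan_iff le_add_diff_inverse power_add)
    then show "of_nat (p choose i) * x ^ i = of_nat p * x ^ 2 * (of_nat (c i) * x ^ (i - 2))"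
      using c[of i] i by (simp add: mult_ac)
  qed
  also have "x ^ p = x * x ^ (p - 1)"
    using p2 by (simp add: power_eq_if)
  finally have "x * (of_nat p * (1 + x * z) + x ^ (p - 1)) = 0"
    by (simp add: algebra_simps power2_eq_square)
  then have *: "of_nat p * (1 + x * z) = - (x ^ (p - 1))"
    using x0 by (simp add: add_eq_0_iff2)
  have x: "x = - (1 - zeta p)"
    by (simp add: x_def)
  have "z \<in> cyclotomic_ints p"
    unfolding z_def x
    by (intro cyclotomic_ints_sum cyclotomic_ints_mult cyclotomic_ints_power cyclotomic_ints_uminus
        cyclotomic_ints_one_minus_zeta) (metis cyclotomic_ints_of_int of_int_of_nat_eq)
  moreover have "- (x ^ (p - 1)) = (- 1) ^ p * (1 - zeta p) ^ (p - 1)"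
    using p2 unfolding x by (subst power_minus) (simp add: power_eq_if[of _ p])
  moreover have "1 + x * z = 1 - (1 - zeta p) * z"
    by (simp add: x algebra_simps)
  ultimately show ?thesis
    using that[of z] * by simp
qed

text \<open>If \<open>1 - zeta p\<close> had an inverse \<open>w\<close>, multiplying the previous
  identity by \<open>w ^ (p - 1)\<close> would make \<open>p\<close> invertible too.\<close>

lemma one_notin_prime_elem_multiples:
  assumes p: "prime p"
  shows "1 \<notin> prime_elem_multiples p"
proof
  assume "1 \<in> prime_elem_multiples p"
  then obtain w where w: "w \<in> cyclotomic_ints p" "(1 - zeta p) * w = 1"
    by (auto simp: prime_elem_multiples_def)
  obtain z where z: "z \<in> cyclotomic_ints p" "of_nat p * (1 - (1 - zeta p) * z) = (- 1) ^ p * (1 - zeta p) ^ (p - 1)"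
    using prime_eq_one_minus_zeta_power[OF p] .
  define y where "y = (- 1) ^ p * (1 - (1 - zeta p) * z) * w ^ (p - 1)"
  have "of_nat p * y = (- 1) ^ p * (of_nat p * (1 - (1 - zeta p) * z)) * w ^ (p - 1)"
    by (simp add: y_def)
  also have "\<dots> = ((- 1) ^ p * (- 1) ^ p) * ((1 - zeta p) * w) ^ (p - 1)"
    unfolding z(2) by (simp only: power_mult_distrib mult_ac)
  also have "\<dots> = 1"
    by (simp add: w flip: power_mult_distrib)
  finally have "of_nat p * y = 1" .
  moreover have "y \<in> cyclotomic_ints p"
    using cyclotomic_ints_add[OF cyclotomic_ints_of_int[of 1] cyclotomic_ints_uminus[OF cyclotomic_ints_mult[OF cyclotomic_ints_one_minus_zeta z(1)]]]
      cyclotomic_ints_of_int[of "-1" p] w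
    unfolding y_def by (intro cyclotomic_ints_mult cyclotomic_ints_power) auto
  ultimately show False
    using inverse_prime_notin_cyclotomic_ints[OF p] by blast
qed

lemma prime_in_prime_elem_multiples:
  assumes p: "prime p"
  shows "of_nat p \<in> prime_elem_multiples p"
proof -
  obtain z where z: "z \<in> cyclotomic_ints p" "of_nat p * (1 - (1 - zeta p) * z) = (- 1) ^ p * (1 - zeta p) ^ (p - 1)"
    using prime_eq_one_minus_zeta_power[OF p] .
  have "(1 - zeta p) ^ (p - 1) = (1 - zeta p) * (1 - zeta p) ^ (p - 2)"
    using prime_ge_2_nat[OF p] by (simp add: power_eq_if numeral_2_eq_2)
  with z(2) have "of_nat p * (1 - (1 - zeta p) * z) = (- 1) ^ p * ((1 - zeta p) * (1 - zeta p) ^ (p - 2))"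
    by (simp only:)
  then have "of_nat p = (1 - zeta p) * (of_nat p * z + (- 1) ^ p * (1 - zeta p) ^ (p - 2))"
    by (simp add: algebra_simps)
  moreover have "of_nat p * z + (- 1) ^ p * (1 - zeta p) ^ (p - 2) \<in> cyclotomic_ints p"
    using z(1) cyclotomic_ints_of_int[of "int p" p] cyclotomic_ints_of_int[of "- 1" p]
    by (intro cyclotomic_ints_add cyclotomic_ints_mult cyclotomic_ints_power cyclotomic_ints_one_minus_zeta) auto
  ultimately show ?thesis
    by (metis prime_elem_multiplesI)
qed

text \<open>An integer prime to \<open>p\<close> in the ideal would by Bezout put 1 there, since
  \<open>p\<close> itself lies in it.\<close>

lemma of_int_in_prime_elem_multiples_iff:
  assumes p: "prime p"
  shows "of_int m \<in> prime_elem_multiples p \<longleftrightarrow> int p dvd m"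
proof
  assume m: "of_int m \<in> prime_elem_multiples p"
  show "int p dvd m"
  proof (rule ccontr)
    assume "\<not> int p dvd m"
    then have "coprime (int p) m"
      using p by (simp add: prime_imp_coprime)
    then obtain u v where "u * int p + v * m = 1"
      using bezout_int[of "int p" m] by (auto simp: coprime_iff_gcd_eq_1)
    then have "(of_int (u * int p + v * m) :: complex) = 1"
      by simp
    then have "of_int u * of_nat p + of_int v * of_int m = (1 :: complex)"
      by simp
    moreover have "of_int u * of_nat p + of_int v * of_int m \<in> prime_elem_multiples p"
      by (intro prime_elem_multiples_add prime_elem_multiples_mult cyclotomic_ints_of_int m
          prime_in_prime_elem_multiples p)
    ultimately show False
      using one_notin_prime_elem_multiples[OF p] by simp
  qed
next
  assume "int p dvd m"
  then obtain n where "m = n * int p"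
    by (metis dvdE mult.commute)
  then show "of_int m \<in> prime_elem_multiples p"
    using prime_elem_multiples_mult[OF cyclotomic_ints_of_int prime_in_prime_elem_multiples[OF p], of n] by simp
qed

text \<open>Modulo \<open>1 - zeta p\<close> the root of unity becomes 1, so \<open>f(zeta)\<close>
  is congruent to the integer \<open>f(1)\<close>. Primality of \<open>1 - zeta p\<close> thus
  reduces to that of \<open>p\<close>.\<close>

lemma eval_in_prime_elem_multiples_iff:
  assumes p: "prime p"
  shows "poly (map_poly of_int f) (zeta p) \<in> prime_elem_multiples p \<longleftrightarrow> int p dvd poly f 1"
proof -
  have "poly (f - [:poly f 1:]) 1 = 0"
    by simp
  then obtain g where "f - [:poly f 1:] = [:-1, 1:] * g"
    by (metis poly_eq_0_iff_dvd dvdE)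
  then have "f = [:poly f 1:] + [:-1, 1:] * g"
    by (simp add: algebra_simps)
  then have "poly (map_poly of_int f) (zeta p) = poly (map_poly of_int ([:poly f 1:] + [:-1, 1:] * g)) (zeta p)"
    by simp
  also have "\<dots> = of_int (poly f 1) + (1 - zeta p) * (- poly (map_poly of_int g) (zeta p))"
    by (simp only: of_int_poly_hom.hom_add of_int_poly_hom.hom_mult poly_add poly_mult)
      (simp only: of_int_hom.map_poly_pCons_hom, simp add: algebra_simps)
  finally have f: "poly (map_poly of_int f) (zeta p) = of_int (poly f 1) + (1 - zeta p) * (- poly (map_poly of_int g) (zeta p))" .
  have g: "(1 - zeta p) * (- poly (map_poly of_int g) (zeta p)) \<in> prime_elem_multiples p"
    by (intro prime_elem_multiplesI cyclotomic_ints_uminus cyclotomic_intsI)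
  have g': "- 1 * ((1 - zeta p) * (- poly (map_poly of_int g) (zeta p))) \<in> prime_elem_multiples p"
    using prime_elem_multiples_mult[OF cyclotomic_ints_of_int g, of "- 1"] by simp
  have "poly (map_poly of_int f) (zeta p) \<in> prime_elem_multiples p \<longleftrightarrow> of_int (poly f 1) \<in> prime_elem_multiples p"
    using prime_elem_multiples_add[OF _ g] prime_elem_multiples_add[OF _ g'] unfolding f by fastforce
  then show ?thesis
    using of_int_in_prime_elem_multiples_iff[OF p] by simp
qed

section \<open>The valuation computed from one representation\<close>

definition nonmultiples :: "nat \<Rightarrow> complex set" where
  "nonmultiples p = cyclotomic_ints p - prime_elem_multiples p"

lemma nonmultiples_mult:
  assumes p: "prime p" and "x \<in> nonmultiples p" "y \<in> nonmultiples p"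
  shows "x * y \<in> nonmultiples p"
proof -
  obtain f g :: "int poly" where f: "x = poly (map_poly of_int f) (zeta p)" and g: "y = poly (map_poly of_int g) (zeta p)"
    using assms by (auto simp: nonmultiples_def elim!: cyclotomic_intsE)
  have "x * y = poly (map_poly of_int (f * g)) (zeta p)"
    by (simp add: f g of_int_poly_hom.hom_mult)
  moreover have "\<not> int p dvd poly (f * g) 1"
    using assms p eval_in_prime_elem_multiples_iff[OF p] by (auto simp: nonmultiples_def f g prime_dvd_mult_iff)
  ultimately show ?thesis
    using eval_in_prime_elem_multiples_iff[OF p] cyclotomic_intsI by (auto simp: nonmultiples_def)
qed

lemma nonmultiples_of_int:
  "prime p \<Longrightarrow> of_int m \<in> nonmultiples p \<longleftrightarrow> \<not> int p dvd m"
  by (simp add: nonmultiples_def cyclotomic_ints_of_int of_int_in_prime_elem_multiples_iff)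

lemma nonmultiples_power: "prime p \<Longrightarrow> x \<in> nonmultiples p \<Longrightarrow> x ^ n \<in> nonmultiples p"
  using nonmultiples_of_int[of p 1] by (induction n) (auto simp: nonmultiples_mult not_prime_unit)

text \<open>The exponent \<open>k\<close> is unique, so a single representation of \<open>x\<close>
  determines the value.\<close>

lemma val_eqI:
  assumes p: "prime p" and a: "a \<in> nonmultiples p" and b: "b \<in> nonmultiples p"
    and x: "x = (1 - zeta p) powi k * a / b"
  shows "val p x = ereal (real_of_int k / real (p - 1))"
proof -
  have z0: "1 - zeta p \<noteq> 0"
    using zeta_power_eq_1_iff[of p 1] prime_gt_1_nat[OF p] by auto
  have "0 \<notin> nonmultiples p"
    using nonmultiples_of_int[OF p, of 0] by simp
  then have nz: "a \<noteq> 0" if "a \<in> nonmultiples p" for a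
    using that by auto
  \<comment> \<open>If \<open>k\<close> exceeded \<open>l\<close>, the surplus factor
    \<open>1 - zeta p\<close> would divide \<open>c * b\<close>, which is a product of nonmultiples.
    Used in both directions, this gives uniqueness.\<close>
  have le: "k \<le> l" if "x = (1 - zeta p) powi k * a / b" "x = (1 - zeta p) powi l * c / e"
    "a \<in> nonmultiples p" "b \<in> nonmultiples p" "c \<in> nonmultiples p" "e \<in> nonmultiples p" for k l a b c e
  proof (rule ccontr)
    assume "\<not> k \<le> l"
    define n where "n = nat (k - l - 1)"
    have kn: "k = l + 1 + int n"
      using \<open>\<not> k \<le> l\<close> by (simp add: n_def)
    have "(1 - zeta p) powi k * a * e = (1 - zeta p) powi l * c * b"
      using that nz[OF that(4)] nz[OF that(6)] by (simp add: field_simps)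
    also have "(1 - zeta p) powi k = (1 - zeta p) powi l * ((1 - zeta p) * (1 - zeta p) ^ n)"
      unfolding kn using z0 by (simp add: power_int_add)
    finally have "c * b = (1 - zeta p) * ((1 - zeta p) ^ n * a * e)"
      using z0 by (simp add: mult.assoc)
    moreover have "(1 - zeta p) ^ n * a * e \<in> cyclotomic_ints p"
      using that by (intro cyclotomic_ints_mult cyclotomic_ints_power cyclotomic_ints_one_minus_zeta) (auto simp: nonmultiples_def)
    ultimately have "c * b \<in> prime_elem_multiples p"
      by (metis prime_elem_multiplesI)
    then show False
      using nonmultiples_mult[OF p that(5,4)] by (simp add: nonmultiples_def)
  qed
  have "(THE k. \<exists>a\<in>nonmultiples p. \<exists>b\<in>nonmultiples p. x = (1 - zeta p) powi k * a / b) = k"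
  proof (rule the_equality)
    fix l assume "\<exists>a\<in>nonmultiples p. \<exists>b\<in>nonmultiples p. x = (1 - zeta p) powi l * a / b"
    then obtain a' b' where l: "a' \<in> nonmultiples p" "b' \<in> nonmultiples p" "x = (1 - zeta p) powi l * a' / b'"
      by blast
    show "l = k"
      using le[OF l(3) x l(1,2) a b] le[OF x l(3) a b l(1,2)] by simp
  qed (use a b x in blast)
  moreover have "x \<noteq> 0"
    using z0 nz a b by (simp add: x)
  ultimately show ?thesis
    by (simp add: val_def nonmultiples_def)
qed

text \<open>Up to sign, \<open>p\<close> is \<open>(1 - zeta p) ^ (p - 1)\<close> divided by an
  element \<open>y\<close> congruent to 1. Each factor \<open>p\<close> thus contributes
  \<open>p - 1\<close> to the exponent, and the denominator in \<open>val\<close> cancels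
  it.\<close>

lemma val_of_int:
  assumes p: "prime p" and m: "m \<noteq> 0"
  shows "val p (of_int m) = ereal (real (multiplicity (int p) m))"
proof -
  define v where "v = multiplicity (int p) m"
  have "\<not> is_unit (int p)"
    using p by (metis not_prime_unit prime_nat_int_transfer)
  then obtain n where n: "m = int p ^ v * n" "\<not> int p dvd n"
    using multiplicity_decompose'[of m "int p"] m unfolding v_def by metis
  obtain z where z: "z \<in> cyclotomic_ints p" "of_nat p * (1 - (1 - zeta p) * z) = (- 1) ^ p * (1 - zeta p) ^ (p - 1)"
    using prime_eq_one_minus_zeta_power[OF p] .
  define y where "y = 1 - (1 - zeta p) * z"
  have y: "y \<in> nonmultiples p"
  proof -
    have "y \<in> cyclotomic_ints p"
      using cyclotomic_ints_add[OF cyclotomic_ints_of_int[of 1] cyclotomic_ints_uminus[OF cyclotomic_ints_mult[OF cyclotomic_ints_one_minus_zeta z(1)]]]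
      by (simp add: y_def)
    moreover have "y \<notin> prime_elem_multiples p"
      using prime_elem_multiples_add[OF _ prime_elem_multiplesI[OF z(1)], of y] one_notin_prime_elem_multiples[OF p]
      by (auto simp: y_def)
    ultimately show ?thesis by (simp add: nonmultiples_def)
  qed
  then have "y \<noteq> 0"
    using nonmultiples_of_int[OF p, of 0] by auto
  have "of_nat p = (- 1) ^ p * (1 - zeta p) ^ (p - 1) / y"
    using z(2) \<open>y \<noteq> 0\<close> unfolding y_def[symmetric] by (simp only: eq_divide_eq) simp
  then have "of_int m = ((- 1) ^ p * (1 - zeta p) ^ (p - 1) / y) ^ v * of_int n"
    by (simp add: n(1))
  also have "\<dots> = (1 - zeta p) powi (int ((p - 1) * v)) * (((- 1) ^ p) ^ v * of_int n) / y ^ v"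
    by (simp only: power_int_of_nat power_divide power_mult_distrib power_mult) simp
  finally have "val p (of_int m) = ereal (real_of_int (int ((p - 1) * v)) / real (p - 1))"
  proof (rule val_eqI[OF p, rotated 2])
    have "(of_int (((- 1) ^ p) ^ v * n) :: complex) \<in> nonmultiples p"
      using n(2) by (subst nonmultiples_of_int[OF p]) (simp add: minus_one_power_iff)
    then show "((- 1) ^ p) ^ v * of_int n \<in> nonmultiples p"
      by simp
  qed (intro nonmultiples_power p y)
  also have "\<dots> = ereal (real v)"
    using prime_gt_1_nat[OF p] by simp
  finally show ?thesis
    by (simp add: v_def)
qed


section \<open>Additive characters and Weil sums\<close>

text \<open>The canonical additive character of the subfield with \<open>CHAR('a) ^ k\<close>
  elements, written as a power of \<open>zeta\<close>; at \<open>k = abs_degree TYPE('a)\<close> it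
  is \<open>canonical_char\<close>.\<close>

definition add_char :: "nat \<Rightarrow> 'a::finite_field \<Rightarrow> complex" where
  "add_char k x = zeta CHAR('a) ^ nat_rep (rel_trace k x)"

definition rel_weil_sum :: "nat \<Rightarrow> nat \<Rightarrow> 'a::finite_field \<Rightarrow> complex" where
  "rel_weil_sum k d a = (\<Sum>x\<in>frob_fixed k. add_char k (x ^ d - a * x))"

lemma frob_fixed_1_fixed: "x \<in> frob_fixed 1 \<Longrightarrow> x ^ (CHAR('a::finite_field) ^ k) = (x::'a)"
  using frob_fixed_mult_right[of x 1 k] by (simp add: frob_fixed_def)

lemma rel_trace_0 [simp]: "rel_trace k 0 = 0"
  by (simp add: rel_trace_def power_0_left)

lemma rel_trace_add: "rel_trace k (x + y) = rel_trace k x + rel_trace k y"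
  by (simp add: rel_trace_def frob_add sum.distrib)

lemma rel_trace_mult: "c \<in> frob_fixed 1 \<Longrightarrow> rel_trace k (c * x) = c * rel_trace k x"
  by (simp add: rel_trace_def power_mult_distrib frob_fixed_1_fixed sum_distrib_left)

lemma rel_trace_frob:
  fixes x :: "'a::finite_field"
  shows "rel_trace k (x ^ (CHAR('a) ^ i)) = rel_trace k x ^ (CHAR('a) ^ i)"
proof -
  have "rel_trace k x ^ (CHAR('a) ^ i) = (\<Sum>j<k. (x ^ (CHAR('a) ^ j)) ^ (CHAR('a) ^ i))"
    unfolding rel_trace_def by (rule freshmans_dream_sum') auto
  also have "\<dots> = rel_trace k (x ^ (CHAR('a) ^ i))"
    unfolding rel_trace_def by (intro sum.cong refl) (metis mult.commute power_mult)
  finally show ?thesis ..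
qed

text \<open>Frobenius shifts the summands cyclically, the last one returning to \<open>x\<close>
  because \<open>x\<close> lies in \<open>frob_fixed k\<close>.\<close>

lemma rel_trace_in:
  assumes "x \<in> frob_fixed k"
  shows "rel_trace k x \<in> frob_fixed 1"
proof -
  let ?f = "\<lambda>i. x ^ (CHAR('a) ^ i)"
  have "rel_trace k x ^ CHAR('a) = (\<Sum>i<k. ?f (Suc i))"
    using rel_trace_frob[of k x 1] unfolding rel_trace_def power_one_right power_Suc power_mult by (rule sym)
  moreover have "?f 0 + (\<Sum>i<k. ?f (Suc i)) = (\<Sum>i<k. ?f i) + ?f k"
    using sum.lessThan_Suc[of ?f k] sum.lessThan_Suc_shift[of ?f k] by simp
  moreover have "?f k = ?f 0"
    using assms by (simp add: frob_fixed_def)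
  ultimately show ?thesis
    by (simp add: frob_fixed_def rel_trace_def)
qed

lemma rel_trace_frob_same:
  assumes "x \<in> frob_fixed k"
  shows "rel_trace k (x ^ (CHAR('a::finite_field) ^ i)) = rel_trace k (x::'a)"
  unfolding rel_trace_frob using assms rel_trace_in frob_fixed_1_fixed by blast

text \<open>Transitivity of the trace: the Frobenius exponents below \<open>2 * k\<close> split at
  \<open>k\<close>.\<close>

lemma rel_trace_double:
  fixes x :: "'a::finite_field"
  shows "rel_trace (2 * k) x = rel_trace k (x + x ^ (CHAR('a) ^ k))"
proof -
  have "(\<Sum>i<k + m. x ^ (CHAR('a) ^ i)) = (\<Sum>i<k. x ^ (CHAR('a) ^ i)) + (\<Sum>i<m. x ^ (CHAR('a) ^ (k + i)))" for m
    by (induction m) (simp_all only: add_0_right lessThan_0 sum.empty add_Suc_right sum.lessThan_Suc add.assoc)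
  then show ?thesis
    unfolding rel_trace_def mult_2 frob_add sum.distrib power_add power_mult .
qed

lemma zeta_nat_rep:
  assumes "of_nat n = (y::'a::finite_field)"
  shows "zeta CHAR('a) ^ nat_rep y = zeta CHAR('a) ^ n"
proof -
  have "y \<in> frob_fixed 1" using assms by auto
  then have "[nat_rep y = n] (mod CHAR('a))"
    using nat_rep(2)[of y] assms of_nat_eq_iff_cong_CHAR[of "nat_rep y" n, where 'a='a] by simp
  then have "zeta CHAR('a) ^ (nat_rep y mod CHAR('a)) = zeta CHAR('a) ^ (n mod CHAR('a))"
    by (simp only: Cong.cong_def)
  then show ?thesis
    by (simp add: zeta_power_mod)
qed

lemma add_char_add:
  assumes "x \<in> frob_fixed k" "y \<in> frob_fixed k"
  shows "add_char k (x + y) = add_char k x * add_char k (y::'a::finite_field)"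
proof -
  have "of_nat (nat_rep (rel_trace k x) + nat_rep (rel_trace k y)) = rel_trace k (x + y)"
    using assms by (simp add: nat_rep(2) rel_trace_in rel_trace_add del: One_nat_def)
  from zeta_nat_rep[OF this] show ?thesis
    by (simp add: add_char_def power_add)
qed

lemma add_char_eq_1_iff:
  assumes "x \<in> frob_fixed k"
  shows "add_char k (x::'a::finite_field) = 1 \<longleftrightarrow> rel_trace k x = 0"
proof -
  note nr = nat_rep[OF rel_trace_in[OF assms]]
  have "add_char k x = 1 \<longleftrightarrow> CHAR('a) dvd nat_rep (rel_trace k x)"
    by (simp add: add_char_def zeta_power_eq_1_iff)
  also have "\<dots> \<longleftrightarrow> rel_trace k x = 0"
    using nr(2) of_nat_eq_0_iff_char_dvd[of "nat_rep (rel_trace k x)", where 'a='a] by simp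
  finally show ?thesis .
qed

lemma add_char_0 [simp]: "add_char k 0 = 1"
  by (simp add: add_char_eq_1_iff)

lemma norm_add_char [simp]: "norm (add_char k x) = 1"
  by (simp add: add_char_def norm_power)

lemma add_char_uminus:
  assumes "x \<in> frob_fixed k"
  shows "add_char k (- x) = cnj (add_char k x)"
proof -
  have "add_char k x * add_char k (- x) = 1"
    using assms by (simp flip: add_char_add)
  moreover have "add_char k x * cnj (add_char k x) = 1"
    by (simp add: complex_norm_square[symmetric])
  ultimately show ?thesis
    by (metis mult_cancel_left mult_zero_left zero_neq_one)
qed

lemma add_char_diff:
  assumes "x \<in> frob_fixed k" "y \<in> frob_fixed k"
  shows "add_char k (x - y) = add_char k x * add_char k (- y)"
  using add_char_add[of x k "- y"] assms by simp

lemma add_char_frob: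
  assumes "x \<in> frob_fixed k"
  shows "add_char k (x ^ (CHAR('a::finite_field) ^ i)) = add_char k (x::'a)"
  using assms by (simp add: add_char_def rel_trace_frob_same)

lemma add_char_double:
  fixes x :: "'a::finite_field"
  shows "add_char (2 * k) x = add_char k (x + x ^ (CHAR('a) ^ k))"
  by (simp add: add_char_def rel_trace_double)

text \<open>For \<open>k = 0\<close> the fixed set is the whole field, which has more than one
  element. The size hypothesis thus supplies \<open>k > 0\<close> wherever it is assumed.\<close>

lemma card_frob_fixed_eq_imp_pos:
  assumes "card (frob_fixed k :: 'a::finite_field set) = CHAR('a) ^ k"
  shows "k > 0"
proof (rule ccontr)
  assume "\<not> k > 0"
  then have "card (UNIV :: 'a set) = 1"
    using assms by (simp add: frob_fixed_def)
  then obtain a :: 'a where "UNIV = {a}"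
    by (rule card_1_singletonE)
  then show False
    by (metis UNIV_I singletonD zero_neq_one)
qed

text \<open>The kernel of the trace consists of roots of a polynomial of degree
  \<open>p ^ (k - 1)\<close>, too few to fill the subfield.\<close>

lemma rel_trace_nontrivial:
  fixes k :: nat
  assumes card: "card (frob_fixed k :: 'a::finite_field set) = CHAR('a) ^ k"
  obtains y where "y \<in> frob_fixed k" "rel_trace k y \<noteq> (0::'a)"
proof -
  obtain j where j: "k = Suc j"
    using card_frob_fixed_eq_imp_pos[OF card] by (cases k) auto
  let ?f = "- (\<Sum>i<j. monom 1 (CHAR('a) ^ i)) :: 'a poly"
  have "degree ?f < CHAR('a) ^ j"
    by (simp, rule degree_sum_less) (auto simp: degree_monom_eq intro!: power_strict_increasing CHAR_ge_2 order.strict_trans2[OF _ CHAR_ge_2])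
  then have "card {x. x ^ (CHAR('a) ^ j) = poly ?f x} \<le> CHAR('a) ^ j"
    by (rule card_power_roots_le)
  also have "{x. x ^ (CHAR('a) ^ j) = poly ?f x} = {x. rel_trace k x = 0}"
    by (auto simp: rel_trace_def j poly_sum poly_monom eq_neg_iff_add_eq_0 add.commute)
  also have "CHAR('a) ^ j < card (frob_fixed k :: 'a set)"
    unfolding card using CHAR_ge_2[where 'a='a] by (simp add: j)
  finally have "card {x::'a. rel_trace k x = 0} < card (frob_fixed k :: 'a set)" .
  then have "\<not> frob_fixed k \<subseteq> {x::'a. rel_trace k x = 0}"
    by (meson card_mono finite linorder_not_le)
  then show ?thesis
    using that by auto
qed

text \<open>Orthogonality: a suitable translation multiplies the sum by a value of the character
  other than 1.\<close>

lemma sum_add_char: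
  assumes card: "card (frob_fixed k :: 'a::finite_field set) = CHAR('a) ^ k"
    and a: "(a::'a) \<in> frob_fixed k"
  shows "(\<Sum>x\<in>frob_fixed k. add_char k (a * x)) = (if a = 0 then of_nat (CHAR('a) ^ k) else 0)"
proof (cases "a = 0")
  case False
  obtain y0 :: 'a where y0: "y0 \<in> frob_fixed k" "rel_trace k y0 \<noteq> 0"
    using rel_trace_nontrivial[OF card] .
  define y where "y = y0 / a"
  have y: "y \<in> frob_fixed k" "a * y = y0"
    using a y0 False by (auto simp: y_def)
  let ?S = "\<Sum>x\<in>frob_fixed k. add_char k (a * x)"
  have "?S = (\<Sum>x\<in>frob_fixed k. add_char k (a * (x + y)))"
    by (rule sum.reindex_bij_witness[of _ "\<lambda>x. x + y" "\<lambda>x. x - y"]) (use y in auto)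
  also have "\<dots> = (\<Sum>x\<in>frob_fixed k. add_char k (a * x) * add_char k y0)"
    using a y y0 by (intro sum.cong refl) (simp add: distrib_left add_char_add)
  also have "\<dots> = ?S * add_char k y0"
    by (simp add: sum_distrib_right)
  finally have "?S * (add_char k y0 - 1) = 0"
    by (simp add: algebra_simps)
  then show ?thesis
    using add_char_eq_1_iff[OF y0(1)] y0(2) False by auto
qed (simp add: card)

section \<open>Power maps, moments and integrality of Weil sums\<close>

lemma bij_betw_power_coprime:
  assumes "d > 0" "k > 0" and "coprime d (CHAR('a::finite_field) ^ k - 1)"
  shows "bij_betw (\<lambda>x. x ^ d) (frob_fixed k) (frob_fixed k :: 'a set)"
proof -
  let ?n = "CHAR('a) ^ k - 1"
  have n: "?n > 0"
    using CHAR_power_gt_1[OF assms(2), where 'a='a] by simp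
  obtain e where "[d * e = 1] (mod ?n)"
    using cong_solve_coprime_nat[OF assms(3)] by auto
  \<comment> \<open>The inverse exponent may come out as 0; adding \<open>?n\<close> makes it
    positive, so that the inverse map also sends 0 to 0.\<close>
  then have "[d * (e + ?n) = 1] (mod ?n)"
    unfolding Cong.cong_def distrib_left by simp
  then have inv: "x ^ (d * (e + ?n)) = x" if "x \<in> frob_fixed k" for x :: 'a
    using frob_fixed_power_cong[of x k "d * (e + ?n)" 1] that assms(1) n by simp
  have "inj_on (\<lambda>x::'a. x ^ d) (frob_fixed k)"
    by (rule inj_on_inverseI[of _ "\<lambda>x. x ^ (e + ?n)"]) (use inv in \<open>simp add: power_mult\<close>)
  then show ?thesis
    by (simp add: bij_betw_def endo_inj_surj image_subset_iff)
qed

text \<open>The power map permutes the subfield, so this is a full sum of a nontrivial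
  character.\<close>

lemma rel_weil_sum_0:
  assumes card: "card (frob_fixed k :: 'a::finite_field set) = CHAR('a) ^ k"
    and "d > 0" and "coprime d (CHAR('a) ^ k - 1)"
  shows "rel_weil_sum k d (0::'a) = 0"
proof -
  have "rel_weil_sum k d (0::'a) = (\<Sum>x\<in>frob_fixed k. add_char k (1 * x :: 'a))"
    unfolding rel_weil_sum_def
    using sum.reindex_bij_betw[OF bij_betw_power_coprime[OF assms(2) card_frob_fixed_eq_imp_pos[OF card] assms(3)], of "add_char k"]
    by simp
  also have "\<dots> = 0"
    by (subst sum_add_char[OF card]) auto
  finally show ?thesis .
qed

lemma rel_weil_sum_altdef:
  assumes "a \<in> frob_fixed k"
  shows "rel_weil_sum k d a = (\<Sum>x\<in>frob_fixed k. add_char k (x ^ d) * add_char k (- x * a))"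
  unfolding rel_weil_sum_def using assms
  by (intro sum.cong refl) (simp add: add_char_diff mult.commute[of a])

text \<open>Summing over \<open>a\<close> first leaves only \<open>x = 0\<close>.\<close>

lemma sum_rel_weil_sum:
  assumes card: "card (frob_fixed k :: 'a::finite_field set) = CHAR('a) ^ k" and "d > 0"
  shows "(\<Sum>a\<in>frob_fixed k. rel_weil_sum k d (a::'a)) = of_nat (CHAR('a) ^ k)"
proof -
  have "(\<Sum>a\<in>frob_fixed k. rel_weil_sum k d (a::'a)) =
      (\<Sum>a\<in>frob_fixed k. \<Sum>x\<in>frob_fixed k. add_char k (x ^ d) * add_char k (- x * a :: 'a))"
    by (intro sum.cong refl rel_weil_sum_altdef)
  also have "\<dots> = (\<Sum>x\<in>frob_fixed k. \<Sum>a\<in>frob_fixed k. add_char k (x ^ d) * add_char k (- x * a :: 'a))"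
    by (rule sum.swap)
  also have "\<dots> = (\<Sum>x\<in>frob_fixed k. add_char k (x ^ d :: 'a) * (if - x = 0 then of_nat (CHAR('a) ^ k) else 0))"
  proof (intro sum.cong refl)
    fix x :: 'a assume "x \<in> frob_fixed k"
    then show "(\<Sum>a\<in>frob_fixed k. add_char k (x ^ d) * add_char k (- x * a)) =
        add_char k (x ^ d) * (if - x = 0 then of_nat (CHAR('a) ^ k) else 0)"
      using sum_add_char[OF card, of "- x"] by (simp flip: sum_distrib_left)
  qed
  also have "\<dots> = (\<Sum>x\<in>frob_fixed k. if (x::'a) = 0 then of_nat (CHAR('a) ^ k) else 0)"
    using assms(2) by (intro sum.cong refl) (simp add: power_0_left)
  also have "\<dots> = of_nat (CHAR('a) ^ k)"
    by (simp add: sum.delta')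
  finally show ?thesis .
qed

text \<open>Parseval: summing over \<open>a\<close> first leaves only the diagonal
  \<open>x = y\<close>.\<close>

lemma sum_norm_rel_weil_sum:
  assumes card: "card (frob_fixed k :: 'a::finite_field set) = CHAR('a) ^ k"
  shows "(\<Sum>a\<in>frob_fixed k. rel_weil_sum k d (a::'a) * cnj (rel_weil_sum k d a)) = of_nat (CHAR('a) ^ k) ^ 2"
proof -
  let ?K = "frob_fixed k :: 'a set"
  have "(\<Sum>a\<in>?K. rel_weil_sum k d a * cnj (rel_weil_sum k d a)) =
      (\<Sum>a\<in>?K. \<Sum>x\<in>?K. \<Sum>y\<in>?K. add_char k (x ^ d - y ^ d) * add_char k ((y - x) * a))"
  proof (rule sum.cong[OF refl])
    fix a :: 'a assume a: "a \<in> ?K"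
    have "rel_weil_sum k d a * cnj (rel_weil_sum k d a) =
      (\<Sum>x\<in>?K. \<Sum>y\<in>?K. add_char k (x ^ d) * add_char k (- x * a) * cnj (add_char k (y ^ d) * add_char k (- y * a)))"
      by (simp add: rel_weil_sum_altdef[OF a] sum_product)
    also have "\<dots> = (\<Sum>x\<in>?K. \<Sum>y\<in>?K. add_char k (x ^ d - y ^ d) * add_char k ((y - x) * a))"
    proof (intro sum.cong refl)
      fix x y assume xy: "x \<in> ?K" "y \<in> ?K"
      have "add_char k ((y - x) * a) = add_char k (- x * a) * add_char k (- (- y * a))"
        using xy a by (simp flip: add_char_add add: algebra_simps)
      moreover have "add_char k (- (- y * a)) = cnj (add_char k (- y * a))"
        by (rule add_char_uminus) (use xy a in auto)
      moreover have "add_char k (x ^ d - y ^ d) = add_char k (x ^ d) * cnj (add_char k (y ^ d))"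
        using xy by (simp add: add_char_diff add_char_uminus)
      ultimately show "add_char k (x ^ d) * add_char k (- x * a) * cnj (add_char k (y ^ d) * add_char k (- y * a)) =
          add_char k (x ^ d - y ^ d) * add_char k ((y - x) * a)"
        by (simp add: mult_ac)
    qed
    finally show "rel_weil_sum k d a * cnj (rel_weil_sum k d a) =
       (\<Sum>x\<in>?K. \<Sum>y\<in>?K. add_char k (x ^ d - y ^ d) * add_char k ((y - x) * a))" .
  qed
  also have "\<dots> = (\<Sum>x\<in>?K. \<Sum>a\<in>?K. \<Sum>y\<in>?K. add_char k (x ^ d - y ^ d) * add_char k ((y - x) * a))"
    by (rule sum.swap)
  also have "\<dots> = (\<Sum>x\<in>?K. \<Sum>y\<in>?K. \<Sum>a\<in>?K. add_char k (x ^ d - y ^ d) * add_char k ((y - x) * a))"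
    by (intro sum.cong refl sum.swap)
  also have "\<dots> = (\<Sum>x\<in>?K. \<Sum>y\<in>?K. add_char k (x ^ d - y ^ d) * (if y - x = 0 then of_nat (CHAR('a) ^ k) else 0))"
  proof (intro sum.cong refl)
    fix x y assume "x \<in> ?K" "y \<in> ?K"
    then show "(\<Sum>a\<in>?K. add_char k (x ^ d - y ^ d) * add_char k ((y - x) * a)) =
        add_char k (x ^ d - y ^ d) * (if y - x = 0 then of_nat (CHAR('a) ^ k) else 0)"
      by (simp only: sum_distrib_left[symmetric] sum_add_char[OF card, of "y - x"] frob_fixed_diff)
  qed
  also have "\<dots> = (\<Sum>x\<in>?K. \<Sum>y\<in>?K. if x = y then of_nat (CHAR('a) ^ k) else 0)"
    by (intro sum.cong refl) auto
  also have "\<dots> = of_nat (CHAR('a) ^ k) ^ 2"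
    by (simp add: card power2_eq_square)
  finally show ?thesis .
qed

text \<open>Replacing \<open>x\<close> by \<open>u * x\<close> with \<open>u\<close> in the prime
  field multiplies \<open>x ^ d - a * x\<close> by \<open>u\<close>, because
  \<open>u ^ d = u\<close>. All nonzero traces are therefore equally frequent, and the nontrivial
  powers of \<open>zeta\<close> sum to -1, so the Weil sum is \<open>N 0 - N 1\<close>.\<close>

lemma rel_weil_sum_int:
  assumes card: "card (frob_fixed k :: 'a::finite_field set) = CHAR('a) ^ k"
    and d: "\<And>c::'a. c \<in> frob_fixed 1 \<Longrightarrow> c ^ d = c" and a: "(a::'a) \<in> frob_fixed k"
  shows "rel_weil_sum k d a \<in> \<int>"
proof -
  let ?K = "frob_fixed k :: 'a set" and ?P = "frob_fixed 1 :: 'a set"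
  define f where "f x = rel_trace k (x ^ d - a * x)" for x
  define N where "N u = card {x\<in>?K. f x = u}" for u
  have PK: "?P \<subseteq> ?K"
    using frob_fixed_mult_right[of _ 1 k] by auto
  have fP: "f x \<in> ?P" if "x \<in> ?K" for x
    unfolding f_def using that a by (intro rel_trace_in) auto
  have f_mult: "f (u * x) = u * f x" if "u \<in> ?P" for u x
  proof -
    have "(u * x) ^ d - a * (u * x) = u * (x ^ d - a * x)"
      using d[OF that] by (simp add: power_mult_distrib algebra_simps)
    then show ?thesis
      unfolding f_def using rel_trace_mult[OF that] by simp
  qed
  have N: "N u = N 1" if u: "u \<in> ?P - {0}" for u
  proof -
    have u0: "u \<noteq> 0" and uP: "u \<in> ?P" "1 / u \<in> ?P"
      using u by (auto simp del: One_nat_def)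
    then have uK: "u \<in> ?K" "1 / u \<in> ?K"
      using PK by blast+
    have "bij_betw (\<lambda>x. u * x) {x\<in>?K. f x = 1} {x\<in>?K. f x = u}"
    proof (rule bij_betw_byWitness[of _ "\<lambda>x. 1 / u * x"])
      show "(\<lambda>x. u * x) ` {x\<in>?K. f x = 1} \<subseteq> {x\<in>?K. f x = u}"
        using uK(1) f_mult[OF uP(1)] by auto
      show "(\<lambda>x. 1 / u * x) ` {x\<in>?K. f x = u} \<subseteq> {x\<in>?K. f x = 1}"
      proof
        fix y assume "y \<in> (\<lambda>x. 1 / u * x) ` {x\<in>?K. f x = u}"
        then obtain x where x: "y = 1 / u * x" "x \<in> ?K" "f x = u"
          by blast
        have "f y = 1"
          unfolding x(1) f_mult[OF uP(2)] x(3) using u0 by simp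
        moreover have "y \<in> ?K"
          unfolding x(1) using uK(2) x(2) by (rule frob_fixed_mult)
        ultimately show "y \<in> {x\<in>?K. f x = 1}"
          by simp
      qed
    qed (use u0 in auto)
    from bij_betw_same_card[OF this] show ?thesis
      unfolding N_def by simp
  qed
  have "(\<Sum>u\<in>?P. zeta CHAR('a) ^ nat_rep u) = (\<Sum>u\<in>?P. add_char 1 (1 * u :: 'a))"
    by (simp add: add_char_def rel_trace_def)
  also have "\<dots> = 0"
    by (subst sum_add_char) (use card_frob_fixed_1[where 'a='a] in \<open>auto simp del: One_nat_def\<close>)
  finally have z: "(\<Sum>u\<in>?P - {0}. zeta CHAR('a) ^ nat_rep u) = - (zeta CHAR('a) ^ nat_rep (0::'a))"
    by (subst (asm) sum.remove[of _ 0]) (auto simp: add_eq_0_iff simp del: One_nat_def)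
  have z0: "zeta CHAR('a) ^ nat_rep (0::'a) = 1"
    using zeta_nat_rep[of 0 "0::'a"] by simp
  have "rel_weil_sum k d a = (\<Sum>x\<in>?K. zeta CHAR('a) ^ nat_rep (f x))"
    by (simp add: rel_weil_sum_def add_char_def f_def)
  also have "\<dots> = (\<Sum>u\<in>?P. \<Sum>x\<in>{x\<in>?K. f x = u}. zeta CHAR('a) ^ nat_rep (f x))"
    by (rule sum.group[symmetric]) (use fP in auto)
  also have "\<dots> = (\<Sum>u\<in>?P. of_nat (N u) * zeta CHAR('a) ^ nat_rep u)"
    by (intro sum.cong refl) (simp add: N_def)
  also have "\<dots> = of_nat (N 0) + (\<Sum>u\<in>?P - {0}. of_nat (N u) * zeta CHAR('a) ^ nat_rep u)"
    by (subst sum.remove[of _ 0]) (auto simp: z0 simp del: One_nat_def)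
  also have "(\<Sum>u\<in>?P - {0}. of_nat (N u) * zeta CHAR('a) ^ nat_rep u)
      = (\<Sum>u\<in>?P - {0}. of_nat (N 1) * zeta CHAR('a) ^ nat_rep u)"
    using N by (intro sum.cong refl) metis
  also have "\<dots> = - of_nat (N 1)"
    by (simp only: z z0 sum_distrib_left[symmetric]) simp
  finally show ?thesis
    by simp
qed


section \<open>The quadratic Hasse--Davenport relation\<close>

text \<open>Trace and norm of the quadratic extension of \<open>frob_fixed k\<close>, whose
  conjugation is the \<open>k\<close>-th power of Frobenius.\<close>

definition quad_trace :: "nat \<Rightarrow> 'a::finite_field \<Rightarrow> 'a" where
  "quad_trace k x = x + x ^ (CHAR('a) ^ k)"

definition quad_norm :: "nat \<Rightarrow> 'a::finite_field \<Rightarrow> 'a" where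
  "quad_norm k x = x * x ^ (CHAR('a) ^ k)"

definition norm_fibre :: "nat \<Rightarrow> 'a::finite_field \<Rightarrow> 'a set" where
  "norm_fibre k e = {x \<in> frob_fixed (2 * k). quad_norm k x = e}"

lemma frob_frob:
  assumes "x \<in> frob_fixed (2 * k)"
  shows "(x ^ (CHAR('a::finite_field) ^ k)) ^ (CHAR('a) ^ k) = (x::'a)"
proof -
  have "(x ^ (CHAR('a) ^ k)) ^ (CHAR('a) ^ k) = x ^ (CHAR('a) ^ (2 * k))"
    by (simp only: power_mult[symmetric] power_add[symmetric] mult_2)
  then show ?thesis
    using assms by (simp only: frob_fixed_def mem_Collect_eq)
qed

lemma quad_trace_in: "x \<in> frob_fixed (2 * k) \<Longrightarrow> quad_trace k x \<in> frob_fixed k"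
  using frob_frob[of x k] by (simp add: frob_fixed_def quad_trace_def frob_add)

lemma quad_norm_in: "x \<in> frob_fixed (2 * k) \<Longrightarrow> quad_norm k x \<in> frob_fixed k"
  using frob_frob[of x k] by (simp add: frob_fixed_def quad_norm_def power_mult_distrib)

lemma quad_norm_mult: "quad_norm k (x * y) = quad_norm k x * quad_norm k y"
  by (simp add: quad_norm_def power_mult_distrib)

lemma quad_norm_divide: "quad_norm k (x / y) = quad_norm k x / quad_norm k y"
  by (simp add: quad_norm_def power_divide)

lemma quad_norm_uminus: "quad_norm k (- x) = quad_norm k x"
  by (simp add: quad_norm_def frob_uminus)

lemma quad_norm_power: "quad_norm k (x ^ n) = quad_norm k x ^ n"
  unfolding quad_norm_def power_mult_distrib by (simp only: power_mult[symmetric] mult.commute)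

lemma quad_norm_eq_0_iff [simp]: "quad_norm k x = 0 \<longleftrightarrow> x = 0"
  by (auto simp: quad_norm_def)

lemma add_char_quad_trace: "add_char (2 * k) x = add_char k (quad_trace k x)"
  by (simp only: add_char_double quad_trace_def)

text \<open>Both sets consist of roots of \<open>X^2 - t X + c\<close>, which settles the disjoint
  case. A common root lies in \<open>frob_fixed k\<close>, hence is its own conjugate and a double
  root, and each set has at most that one element.\<close>

lemma quad_count_le_2:
  "card {x \<in> frob_fixed (2 * k). quad_trace k x = t \<and> quad_norm k x = c}
    + card {y \<in> frob_fixed k. y * (t - y) = (c::'a::finite_field)} \<le> 2" (is "card ?S + card ?T \<le> 2")
proof -
  let ?R = "{x. x ^ 2 = poly [:- c, t:] x}"
  have R: "card ?R \<le> 2"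
    by (rule card_power_roots_le) auto
  have S: "?S \<subseteq> ?R"
  proof
    fix x assume "x \<in> ?S"
    then have "x ^ (CHAR('a) ^ k) = t - x" "x * x ^ (CHAR('a) ^ k) = c"
      by (auto simp: quad_trace_def quad_norm_def)
    then have "x * (t - x) = c" by simp
    then show "x \<in> ?R"
      by (auto simp: power2_eq_square algebra_simps)
  qed
  have T: "?T \<subseteq> ?R"
    by (auto simp: power2_eq_square algebra_simps)
  show ?thesis
  proof (cases "?S \<inter> ?T = {}")
    case True
    then have "card ?S + card ?T = card (?S \<union> ?T)"
      by (simp add: card_Un_disjoint)
    also have "\<dots> \<le> card ?R"
      using S T by (intro card_mono) auto
    finally show ?thesis
      using R by simp
  next
    case False
    then obtain z where z: "z \<in> ?S" "z \<in> ?T"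
      by blast
    then have tc: "t = z + z" "c = z * z"
      by (auto simp: quad_trace_def quad_norm_def frob_fixed_def)
    have "?R \<subseteq> {z}"
    proof
      fix x assume "x \<in> ?R"
      then have "(x - z) * (x - z) = 0"
        by (simp add: tc power2_eq_square algebra_simps)
      then show "x \<in> {z}" by simp
    qed
    then have "card ?S \<le> card {z}" "card ?T \<le> card {z}"
      using S T by (intro card_mono; blast)+
    then show ?thesis by simp
  qed
qed

text \<open>Summed over all \<open>(t, c)\<close>, both sides of the previous bound are \<open>2 Q\<^sup>2\<close>.\<close>
lemma quad_count:
  assumes cardK: "card (frob_fixed k :: 'a::finite_field set) = CHAR('a) ^ k"
    and cardL: "card (frob_fixed (2 * k) :: 'a set) = CHAR('a) ^ (2 * k)"
    and tc: "t \<in> frob_fixed k" "c \<in> frob_fixed k"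
  shows "card {x \<in> frob_fixed (2 * k). quad_trace k x = t \<and> quad_norm k x = c}
    + card {y \<in> frob_fixed k. y * (t - y) = (c::'a)} = 2"
proof -
  let ?K = "frob_fixed k :: 'a set" and ?L = "frob_fixed (2 * k) :: 'a set"
  let ?S = "\<lambda>u. {x \<in> ?L. (quad_trace k x, quad_norm k x) = u}" and ?T = "\<lambda>t c. {y \<in> ?K. y * (t - y) = c}"
  have "(\<Sum>u\<in>?K \<times> ?K. card (?S u)) = (\<Sum>x\<in>?L. 1)"
    unfolding card_eq_sum by (rule sum.group) (auto simp: quad_trace_in quad_norm_in)
  then have 1: "(\<Sum>u\<in>?K \<times> ?K. card (?S u)) = card ?K * card ?K"
    unfolding cardK by (simp add: cardL power2_eq_square power_even_eq)
  have "(\<Sum>c\<in>?K. card (?T t c)) = card ?K" if "t \<in> ?K" for t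
  proof -
    have "(\<Sum>c\<in>?K. card (?T t c)) = (\<Sum>y\<in>?K. 1)"
      unfolding card_eq_sum by (rule sum.group) (use that in auto)
    then show ?thesis by simp
  qed
  then have "(\<Sum>t\<in>?K. \<Sum>c\<in>?K. card (?T t c)) = card ?K * card ?K"
    by simp
  then have 2: "(\<Sum>u\<in>?K \<times> ?K. card (?T (fst u) (snd u))) = card ?K * card ?K"
    by (simp add: sum.cartesian_product case_prod_unfold)
  have "card (?S u) + card (?T (fst u) (snd u)) = 2" if "u \<in> ?K \<times> ?K" for u
  \<comment> \<open>A family bounded termwise by 2 whose total is the largest possible is constantly
    2.\<close>
  proof (rule sum_mono_inv[OF _ _ that])
    show "(\<Sum>u\<in>?K \<times> ?K. card (?S u) + card (?T (fst u) (snd u))) = (\<Sum>u\<in>?K \<times> ?K. 2)"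
      by (simp add: sum.distrib 1 2)
    show "card (?S u) + card (?T (fst u) (snd u)) \<le> 2" for u
      using quad_count_le_2[of k "fst u" "snd u"] by (simp add: prod_eq_iff)
  qed auto
  from this[of "(t, c)"] show ?thesis
    using tc by simp
qed

text \<open>Sorting by \<open>t\<close> turns both sums into weighted sums: the weights count the
  elements of norm \<open>e\<close> and trace \<open>t\<close> in one, the factorisations
  \<open>e = y * (t - y)\<close> in the other. These numbers add up to 2 for every
  \<open>t\<close>.\<close>

lemma sum_norm_fibre:
  fixes F :: "'a::finite_field \<Rightarrow> complex"
  assumes cardK: "card (frob_fixed k :: 'a set) = CHAR('a) ^ k"
    and cardL: "card (frob_fixed (2 * k) :: 'a set) = CHAR('a) ^ (2 * k)"
    and e: "e \<in> frob_fixed k - {0}"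
  shows "(\<Sum>x\<in>norm_fibre k e. F (quad_trace k x)) + (\<Sum>b\<in>frob_fixed k - {0}. F (b + e / b))
    = 2 * (\<Sum>t\<in>frob_fixed k. F t)"
proof -
  let ?K = "frob_fixed k :: 'a set" and ?L = "frob_fixed (2 * k) :: 'a set"
  let ?S = "\<lambda>t. {x \<in> ?L. quad_trace k x = t \<and> quad_norm k x = e}" and ?T = "\<lambda>t. {y \<in> ?K. y * (t - y) = e}"
  have "(\<Sum>x\<in>norm_fibre k e. F (quad_trace k x)) = (\<Sum>t\<in>?K. \<Sum>x\<in>{x\<in>norm_fibre k e. quad_trace k x = t}. F (quad_trace k x))"
    by (rule sum.group[symmetric]) (auto simp: norm_fibre_def quad_trace_in)
  also have "\<dots> = (\<Sum>t\<in>?K. of_nat (card (?S t)) * F t)"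
  proof (intro sum.cong refl)
    fix t
    have "{x\<in>norm_fibre k e. quad_trace k x = t} = ?S t"
      by (auto simp: norm_fibre_def)
    then show "(\<Sum>x\<in>{x\<in>norm_fibre k e. quad_trace k x = t}. F (quad_trace k x)) = of_nat (card (?S t)) * F t"
      by simp
  qed
  finally have 1: "(\<Sum>x\<in>norm_fibre k e. F (quad_trace k x)) = (\<Sum>t\<in>?K. of_nat (card (?S t)) * F t)" .
  have "(\<Sum>b\<in>?K - {0}. F (b + e / b)) = (\<Sum>t\<in>?K. \<Sum>b\<in>{b\<in>?K - {0}. b + e / b = t}. F (b + e / b))"
    by (rule sum.group[symmetric]) (use e in auto)
  also have "\<dots> = (\<Sum>t\<in>?K. of_nat (card (?T t)) * F t)"
  proof (intro sum.cong refl)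
    fix t
    have "{b\<in>?K - {0}. b + e / b = t} = ?T t"
    proof (intro equalityI subsetI)
      fix b assume "b \<in> ?T t"
      moreover from this e have "b \<noteq> 0"
        by auto
      ultimately show "b \<in> {b\<in>?K - {0}. b + e / b = t}"
        by (auto simp: field_simps)
    qed (auto simp: field_simps)
    moreover have "(\<Sum>b\<in>{b\<in>?K - {0}. b + e / b = t}. F (b + e / b)) = (\<Sum>b\<in>{b\<in>?K - {0}. b + e / b = t}. F t)"
      by (intro sum.cong refl) auto
    ultimately show "(\<Sum>b\<in>{b\<in>?K - {0}. b + e / b = t}. F (b + e / b)) = of_nat (card (?T t)) * F t"
      by simp
  qed
  finally have "(\<Sum>x\<in>norm_fibre k e. F (quad_trace k x)) + (\<Sum>b\<in>?K - {0}. F (b + e / b))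
     = (\<Sum>t\<in>?K. of_nat (card (?S t) + card (?T t)) * F t)"
    by (simp add: 1 sum.distrib distrib_right)
  also have "\<dots> = (\<Sum>t\<in>?K. 2 * F t)"
  proof (intro sum.cong refl)
    fix t assume "t \<in> ?K"
    then have "card (?S t) + card (?T t) = 2"
      using e by (intro quad_count[OF cardK cardL]) auto
    then show "of_nat (card (?S t) + card (?T t)) * F t = 2 * F t"
      by (simp only: of_nat_numeral)
  qed
  finally show ?thesis
    by (simp add: sum_distrib_left)
qed

text \<open>With the constant weight 1, the size of the fibre plus \<open>Q - 1\<close> equals
  \<open>2 * Q\<close>, where \<open>Q = CHAR('a) ^ k\<close>.\<close>

lemma card_norm_fibre:
  assumes cardK: "card (frob_fixed k :: 'a::finite_field set) = CHAR('a) ^ k"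
    and cardL: "card (frob_fixed (2 * k) :: 'a set) = CHAR('a) ^ (2 * k)"
    and e: "(e::'a) \<in> frob_fixed k - {0}"
  shows "card (norm_fibre k e) = CHAR('a) ^ k + 1"
proof -
  have "of_nat (card (norm_fibre k e) + (CHAR('a) ^ k - 1)) = (of_nat (2 * CHAR('a) ^ k) :: complex)"
    using sum_norm_fibre[OF cardK cardL e, of "\<lambda>_. 1"] by (simp add: cardK)
  then have "card (norm_fibre k e) + (CHAR('a) ^ k - 1) = 2 * CHAR('a) ^ k"
    by (simp only: of_nat_eq_iff)
  moreover have "CHAR('a) ^ k \<ge> 1"
    by (simp add: Suc_leI)
  ultimately show ?thesis by linarith
qed

text \<open>The Kloosterman sum, that is, the multiplicative convolution square at \<open>e\<close>
  of the additive character restricted to nonzero elements.\<close>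

definition kloosterman :: "nat \<Rightarrow> 'a::finite_field \<Rightarrow> complex" where
  "kloosterman k e = (\<Sum>b\<in>frob_fixed k - {0}. add_char k (b + e / b))"

text \<open>The quadratic Hasse--Davenport relation, one norm fibre at a time.\<close>
lemma sum_add_char_norm_fibre:
  assumes cardK: "card (frob_fixed k :: 'a::finite_field set) = CHAR('a) ^ k"
    and cardL: "card (frob_fixed (2 * k) :: 'a set) = CHAR('a) ^ (2 * k)"
    and e: "(e::'a) \<in> frob_fixed k - {0}"
  shows "(\<Sum>x\<in>norm_fibre k e. add_char (2 * k) x) = - kloosterman k e"
proof -
  have "(\<Sum>t\<in>frob_fixed k. add_char k (t::'a)) = 0"
    using sum_add_char[OF cardK, of 1] by simp
  then show ?thesis
    using sum_norm_fibre[OF cardK cardL e, of "add_char k"]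
    by (simp add: add_char_quad_trace kloosterman_def add_eq_0_iff2)
qed

section \<open>Push-forward along the norm and convolution square, both through Kloosterman
  sums\<close>

lemma rel_weil_sum_split_0:
  assumes "a \<in> frob_fixed k" "d > 0"
  shows "rel_weil_sum k d a = 1 + (\<Sum>x\<in>frob_fixed k - {0}. add_char k (x ^ d) * add_char k (- x * a))"
  unfolding rel_weil_sum_altdef[OF assms(1)] using assms(2)
  by (subst sum.remove[of _ 0]) (auto simp: power_0_left)

text \<open>The terms \<open>x = 0\<close> give the number of elements in the fibre. For the others,
  the sum over \<open>a\<close> and the sum over all \<open>x\<close> of norm \<open>e\<close> each
  yield a negated Kloosterman sum, and the signs cancel.\<close>

lemma sum_rel_weil_sum_norm_fibre_eq_kloosterman:
  assumes cardK: "card (frob_fixed k :: 'a::finite_field set) = CHAR('a) ^ k"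
    and cardL: "card (frob_fixed (2 * k) :: 'a set) = CHAR('a) ^ (2 * k)"
    and d: "d > 0" "coprime d (CHAR('a) ^ (2 * k) - 1)" "coprime d (CHAR('a) ^ k - 1)"
    and c: "c \<in> frob_fixed k - {0}"
  shows "(\<Sum>a\<in>norm_fibre k c. rel_weil_sum (2 * k) d (a::'a)) =
    of_nat (CHAR('a) ^ k + 1) + (\<Sum>e\<in>frob_fixed k - {0}. kloosterman k (c * e) * kloosterman k (e ^ d))"
proof -
  let ?K = "frob_fixed k :: 'a set" and ?L = "frob_fixed (2 * k) :: 'a set"
  let ?\<psi> = "add_char (2 * k) :: 'a \<Rightarrow> complex"
  have k0: "k > 0" "2 * k > 0"
    using card_frob_fixed_eq_imp_pos[OF cardK] by auto
  \<comment> \<open>Multiplication by \<open>- x\<close> carries the norm fibre over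
    \<open>c\<close> to the one over \<open>c * quad_norm k x\<close>.\<close>
  have twist: "(\<Sum>a\<in>norm_fibre k c. ?\<psi> (- x * a)) = - kloosterman k (c * quad_norm k x)" if x: "x \<in> ?L - {0}" for x
  proof -
    have "(\<Sum>a\<in>norm_fibre k c. ?\<psi> (- x * a)) = (\<Sum>u\<in>norm_fibre k (c * quad_norm k x). ?\<psi> u)"
      by (rule sum.reindex_bij_witness[of _ "\<lambda>u. u / (- x)" "\<lambda>a. - x * a"])
        (use x in \<open>auto simp: norm_fibre_def quad_norm_mult quad_norm_uminus quad_norm_divide\<close>)
    also have "\<dots> = - kloosterman k (c * quad_norm k x)"
      using c x quad_norm_in[of x k] by (intro sum_add_char_norm_fibre cardK cardL) auto
    finally show ?thesis .
  qed
  \<comment> \<open>The power map carries the fibre over \<open>e\<close> onto the fibre over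
    \<open>e ^ d\<close>: it is bijective on the larger field, and injectivity on the smaller one
    recovers the norm \<open>e\<close>.\<close>
  have powers: "(\<Sum>x\<in>norm_fibre k e. ?\<psi> (x ^ d)) = - kloosterman k (e ^ d)" if e: "e \<in> ?K - {0}" for e
  proof -
    note bijL = bij_betw_power_coprime[OF d(1) k0(2) d(2)] and bijK = bij_betw_power_coprime[OF d(1) k0(1) d(3)]
    have "bij_betw (\<lambda>x. x ^ d) (norm_fibre k e) (norm_fibre k (e ^ d))"
      unfolding bij_betw_def
    proof
      show "inj_on (\<lambda>x. x ^ d) (norm_fibre k e)"
        using bijL unfolding bij_betw_def by (rule inj_on_subset[OF conjunct1]) (auto simp: norm_fibre_def)
      show "(\<lambda>x. x ^ d) ` norm_fibre k e = norm_fibre k (e ^ d)"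
      proof (intro equalityI subsetI)
        fix y assume "y \<in> norm_fibre k (e ^ d)"
        then have y: "y \<in> ?L" "quad_norm k y = e ^ d"
          by (auto simp: norm_fibre_def)
        then obtain x where x: "x \<in> ?L" "y = x ^ d"
          using bijL unfolding bij_betw_def by blast
        have "quad_norm k x ^ d = e ^ d"
          using x y by (simp add: quad_norm_power)
        then have "quad_norm k x = e"
          using bijK e quad_norm_in[OF x(1)] unfolding bij_betw_def inj_on_def by blast
        then show "y \<in> (\<lambda>x. x ^ d) ` norm_fibre k e"
          using x by (auto simp: norm_fibre_def)
      qed (auto simp: norm_fibre_def quad_norm_power)
    qed
    then have "(\<Sum>x\<in>norm_fibre k e. ?\<psi> (x ^ d)) = (\<Sum>u\<in>norm_fibre k (e ^ d). ?\<psi> u)"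
      by (rule sum.reindex_bij_betw)
    also have "\<dots> = - kloosterman k (e ^ d)"
      using e by (intro sum_add_char_norm_fibre cardK cardL) auto
    finally show ?thesis .
  qed
  have "(\<Sum>a\<in>norm_fibre k c. rel_weil_sum (2 * k) d a) =
      (\<Sum>a\<in>norm_fibre k c. 1 + (\<Sum>x\<in>?L - {0}. ?\<psi> (x ^ d) * ?\<psi> (- x * a)))"
    by (intro sum.cong refl rel_weil_sum_split_0 d) (auto simp: norm_fibre_def)
  also have "\<dots> = of_nat (CHAR('a) ^ k + 1) + (\<Sum>x\<in>?L - {0}. \<Sum>a\<in>norm_fibre k c. ?\<psi> (x ^ d) * ?\<psi> (- x * a))"
    unfolding sum.distrib card_eq_sum[symmetric] by (subst sum.swap) (simp add: card_norm_fibre[OF cardK cardL c])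
  also have "(\<Sum>x\<in>?L - {0}. \<Sum>a\<in>norm_fibre k c. ?\<psi> (x ^ d) * ?\<psi> (- x * a)) =
      (\<Sum>x\<in>?L - {0}. ?\<psi> (x ^ d) * - kloosterman k (c * quad_norm k x))"
    by (intro sum.cong refl) (simp only: sum_distrib_left[symmetric] twist)
  also have "\<dots> = (\<Sum>e\<in>?K - {0}. \<Sum>x\<in>{x\<in>?L - {0}. quad_norm k x = e}. ?\<psi> (x ^ d) * - kloosterman k (c * quad_norm k x))"
    by (rule sum.group[symmetric]) (auto simp: quad_norm_in)
  also have "\<dots> = (\<Sum>e\<in>?K - {0}. kloosterman k (c * e) * kloosterman k (e ^ d))"
  proof (intro sum.cong refl)
    fix e assume e: "e \<in> ?K - {0}"
    then have "{x\<in>?L - {0}. quad_norm k x = e} = norm_fibre k e"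
      by (auto simp: norm_fibre_def)
    then have "(\<Sum>x\<in>{x\<in>?L - {0}. quad_norm k x = e}. ?\<psi> (x ^ d) * - kloosterman k (c * quad_norm k x)) =
        (\<Sum>x\<in>norm_fibre k e. ?\<psi> (x ^ d) * - kloosterman k (c * e))"
      by (intro sum.cong) (auto simp: norm_fibre_def)
    also have "\<dots> = kloosterman k (c * e) * kloosterman k (e ^ d)"
      by (simp only: sum_distrib_right[symmetric] powers[OF e]) simp
    finally show "(\<Sum>x\<in>{x\<in>?L - {0}. quad_norm k x = e}. ?\<psi> (x ^ d) * - kloosterman k (c * quad_norm k x)) =
        kloosterman k (c * e) * kloosterman k (e ^ d)" .
  qed
  finally show ?thesis .
qed

text \<open>With \<open>W = 1 + A\<close>, the convolution expands into \<open>Q - 1\<close> ones,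
  two sums of \<open>A\<close> equal to 1, and a convolution of \<open>A\<close> that consists of
  Kloosterman sums. The constants add up to the same \<open>Q + 1\<close> as for the norm
  fibre.\<close>

lemma rel_weil_sum_convolution_eq_kloosterman:
  assumes cardK: "card (frob_fixed k :: 'a::finite_field set) = CHAR('a) ^ k"
    and d: "d > 0" "coprime d (CHAR('a) ^ k - 1)"
    and c: "c \<in> frob_fixed k - {0}"
  shows "(\<Sum>b\<in>frob_fixed k - {0}. rel_weil_sum k d b * rel_weil_sum k d (c / b :: 'a)) =
    of_nat (CHAR('a) ^ k + 1) + (\<Sum>e\<in>frob_fixed k - {0}. kloosterman k (c * e) * kloosterman k (e ^ d))"
proof -
  let ?K = "frob_fixed k :: 'a set" and ?\<psi> = "add_char k :: 'a \<Rightarrow> complex"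
  define A where "A b = (\<Sum>y\<in>?K - {0}. ?\<psi> (y ^ d) * ?\<psi> (- y * b))" for b
  have W: "rel_weil_sum k d b = 1 + A b" if "b \<in> ?K" for b
    unfolding A_def by (rule rel_weil_sum_split_0[OF that d(1)])
  have k0: "k > 0"
    using card_frob_fixed_eq_imp_pos[OF cardK] .
  have Q: "CHAR('a) ^ k \<ge> 1"
    by (simp add: Suc_leI)
  \<comment> \<open>Since \<open>W(0) = 0\<close>, the first moment is unchanged when 0 is left out;
    subtracting \<open>Q - 1\<close> ones from \<open>Q\<close> leaves 1.\<close>
  have "(\<Sum>b\<in>?K - {0}. 1 + A b) = (\<Sum>b\<in>?K - {0}. rel_weil_sum k d b)"
    by (intro sum.cong refl) (simp add: W)
  also have "\<dots> = of_nat (CHAR('a) ^ k)"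
    using sum_rel_weil_sum[OF cardK d(1)] rel_weil_sum_0[OF cardK d] by (subst (asm) sum.remove[of _ 0]) auto
  finally have A1: "(\<Sum>b\<in>?K - {0}. A b) = 1"
    using Q by (simp add: sum.distrib cardK of_nat_diff)
  have A2: "(\<Sum>b\<in>?K - {0}. A (c / b)) = 1"
    unfolding A1[symmetric]
    by (rule sum.reindex_bij_witness[of _ "\<lambda>b. c / b" "\<lambda>b. c / b"]) (use c in auto)
  have twist: "(\<Sum>b\<in>?K - {0}. ?\<psi> (- y * b) * ?\<psi> (- z * (c / b))) = kloosterman k (c * (y * z))"
    if yz: "y \<in> ?K - {0}" "z \<in> ?K - {0}" for y z
    unfolding kloosterman_def
  proof (rule sum.reindex_bij_witness[of _ "\<lambda>b. b / (- y)" "\<lambda>b. - y * b"])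
    fix b assume b: "b \<in> ?K - {0}"
    have eq: "c * (y * z) / (- y * b) = - z * (c / b)"
      using yz by (simp add: field_simps)
    show "?\<psi> (- y * b + c * (y * z) / (- y * b)) = ?\<psi> (- y * b) * ?\<psi> (- z * (c / b))"
      unfolding eq using b yz c by (intro add_char_add frob_fixed_divide frob_fixed_mult) auto
  qed (use yz in auto)
  have powers: "(\<Sum>y\<in>?K - {0}. ?\<psi> (y ^ d) * ?\<psi> ((e / y) ^ d)) = kloosterman k (e ^ d)" if e: "e \<in> ?K - {0}" for e
  proof -
    note bijK = bij_betw_power_coprime[OF d(1) k0 d(2)]
    have bij: "bij_betw (\<lambda>x. x ^ d) (?K - {0}) (?K - {0})"
      using bij_betw_DiffI[OF bijK, of "{0}" "{0}"] d(1) by (simp add: bij_betw_def power_0_left)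
    have "(\<Sum>y\<in>?K - {0}. ?\<psi> (y ^ d) * ?\<psi> ((e / y) ^ d)) = (\<Sum>y\<in>?K - {0}. ?\<psi> (y ^ d + e ^ d / y ^ d))"
      using e by (intro sum.cong refl) (simp add: add_char_add power_divide)
    also have "\<dots> = kloosterman k (e ^ d)"
      unfolding kloosterman_def by (rule sum.reindex_bij_betw[OF bij])
    finally show ?thesis .
  qed
  have "(\<Sum>b\<in>?K - {0}. A b * A (c / b)) =
      (\<Sum>b\<in>?K - {0}. \<Sum>y\<in>?K - {0}. \<Sum>z\<in>?K - {0}. ?\<psi> (y ^ d) * ?\<psi> (z ^ d) * (?\<psi> (- y * b) * ?\<psi> (- z * (c / b))))"
    unfolding A_def sum_product by (intro sum.cong refl) (simp only: mult_ac)
  also have "\<dots> = (\<Sum>y\<in>?K - {0}. \<Sum>b\<in>?K - {0}. \<Sum>z\<in>?K - {0}. ?\<psi> (y ^ d) * ?\<psi> (z ^ d) * (?\<psi> (- y * b) * ?\<psi> (- z * (c / b))))"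
    by (rule sum.swap)
  also have "\<dots> = (\<Sum>y\<in>?K - {0}. \<Sum>z\<in>?K - {0}. \<Sum>b\<in>?K - {0}. ?\<psi> (y ^ d) * ?\<psi> (z ^ d) * (?\<psi> (- y * b) * ?\<psi> (- z * (c / b))))"
    by (intro sum.cong refl sum.swap)
  also have "\<dots> = (\<Sum>y\<in>?K - {0}. \<Sum>z\<in>?K - {0}. ?\<psi> (y ^ d) * ?\<psi> (z ^ d) * kloosterman k (c * (y * z)))"
    by (intro sum.cong refl) (simp only: sum_distrib_left[symmetric] twist)
  \<comment> \<open>The variable \<open>z\<close> is replaced by \<open>e = y * z\<close>.\<close>
  also have "\<dots> = (\<Sum>y\<in>?K - {0}. \<Sum>e\<in>?K - {0}. ?\<psi> (y ^ d) * ?\<psi> ((e / y) ^ d) * kloosterman k (c * e))"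
  proof (rule sum.cong[OF refl])
    fix y assume "y \<in> ?K - {0}"
    then show "(\<Sum>z\<in>?K - {0}. ?\<psi> (y ^ d) * ?\<psi> (z ^ d) * kloosterman k (c * (y * z))) =
        (\<Sum>e\<in>?K - {0}. ?\<psi> (y ^ d) * ?\<psi> ((e / y) ^ d) * kloosterman k (c * e))"
      by (intro sum.reindex_bij_witness[of _ "\<lambda>e. e / y" "\<lambda>z. y * z"]) auto
  qed
  also have "\<dots> = (\<Sum>e\<in>?K - {0}. \<Sum>y\<in>?K - {0}. ?\<psi> (y ^ d) * ?\<psi> ((e / y) ^ d) * kloosterman k (c * e))"
    by (rule sum.swap)
  also have "\<dots> = (\<Sum>e\<in>?K - {0}. kloosterman k (c * e) * kloosterman k (e ^ d))"
    by (intro sum.cong refl, simp only: sum_distrib_right[symmetric] powers) (rule mult.commute)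
  finally have AA: "(\<Sum>b\<in>?K - {0}. A b * A (c / b)) = (\<Sum>e\<in>?K - {0}. kloosterman k (c * e) * kloosterman k (e ^ d))" .
  have "(\<Sum>b\<in>?K - {0}. rel_weil_sum k d b * rel_weil_sum k d (c / b)) =
      (\<Sum>b\<in>?K - {0}. 1 + A b + A (c / b) + A b * A (c / b))"
    using c by (intro sum.cong refl) (simp add: W algebra_simps)
  also have "\<dots> = of_nat (card (?K - {0})) + 1 + 1 + (\<Sum>b\<in>?K - {0}. A b * A (c / b))"
    by (simp only: sum.distrib A1 A2) simp
  also have "of_nat (card (?K - {0})) = (of_nat (CHAR('a) ^ k) - 1 :: complex)"
    using Q by (simp add: cardK of_nat_diff)
  finally show ?thesis
    by (simp add: AA)
qed

text \<open>The Hasse--Davenport relation in the form used by the tower, stated without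
  multiplicative characters.\<close>

lemma sum_rel_weil_sum_norm_fibre:
  assumes cardK: "card (frob_fixed k :: 'a::finite_field set) = CHAR('a) ^ k"
    and cardL: "card (frob_fixed (2 * k) :: 'a set) = CHAR('a) ^ (2 * k)"
    and d: "d > 0" "coprime d (CHAR('a) ^ (2 * k) - 1)" "coprime d (CHAR('a) ^ k - 1)"
    and c: "c \<in> frob_fixed k - {0}"
  shows "(\<Sum>a\<in>norm_fibre k c. rel_weil_sum (2 * k) d (a::'a)) =
    (\<Sum>b\<in>frob_fixed k - {0}. rel_weil_sum k d b * rel_weil_sum k d (c / b))"
  by (simp only: sum_rel_weil_sum_norm_fibre_eq_kloosterman[OF assms]
      rel_weil_sum_convolution_eq_kloosterman[OF cardK d(1,3) c])


section \<open>Divisibility of convolution squares and Niho exponents\<close>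

text \<open>Discrete Fourier transform with values in the field itself, the characters being \<open>x \<mapsto> x ^ j\<close>;
  it turns convolution squares into squares.\<close>
lemma convolution_dvd:
  fixes f :: "'a::finite_field \<Rightarrow> int"
  assumes cardK: "card (frob_fixed k :: 'a set) = CHAR('a) ^ k"
    and conv: "\<And>c. c \<in> frob_fixed k - {0} \<Longrightarrow> int CHAR('a) dvd (\<Sum>b\<in>frob_fixed k - {0}. f b * f (c / b))"
    and b: "b \<in> frob_fixed k - {0}"
  shows "int CHAR('a) dvd f b"
proof -
  let ?K = "frob_fixed k - {0} :: 'a set" and ?n = "CHAR('a) ^ k - 1"
  \<comment> \<open>\<open>g j\<close> is the Fourier coefficient of \<open>f\<close> at the
    character \<open>x \<mapsto> x ^ j\<close>. Its square is that of the convolution, which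
    vanishes in characteristic \<open>p\<close>.\<close>
  define g where "g j = (\<Sum>x\<in>?K. of_int (f x) * x ^ j)" for j
  have "g j = 0" for j
  proof -
    have "g j * g j = (\<Sum>x\<in>?K. \<Sum>y\<in>?K. of_int (f x * f y) * (x * y) ^ j)"
      unfolding g_def sum_product by (intro sum.cong refl) (simp add: power_mult_distrib mult_ac)
    also have "\<dots> = (\<Sum>x\<in>?K. \<Sum>c\<in>?K. of_int (f x * f (c / x)) * c ^ j)"
    proof (rule sum.cong[OF refl])
      fix x assume "x \<in> ?K"
      then show "(\<Sum>y\<in>?K. of_int (f x * f y) * (x * y) ^ j) = (\<Sum>c\<in>?K. of_int (f x * f (c / x)) * c ^ j)"
        by (intro sum.reindex_bij_witness[of _ "\<lambda>c. c / x" "\<lambda>y. x * y"]) auto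
    qed
    also have "\<dots> = (\<Sum>c\<in>?K. \<Sum>x\<in>?K. of_int (f x * f (c / x)) * c ^ j)"
      by (rule sum.swap)
    also have "\<dots> = (\<Sum>c\<in>?K. of_int (\<Sum>x\<in>?K. f x * f (c / x)) * c ^ j)"
      by (simp add: sum_distrib_right)
    also have "\<dots> = 0"
    proof (intro sum.neutral ballI)
      fix c assume "c \<in> ?K"
      then have "of_int (\<Sum>x\<in>?K. f x * f (c / x)) = (0::'a)"
        unfolding of_int_eq_0_iff_char_dvd by (rule conv)
      then show "of_int (\<Sum>x\<in>?K. f x * f (c / x)) * c ^ j = 0"
        by (simp only: mult_zero_left)
    qed
    finally show ?thesis by simp
  qed
  \<comment> \<open>Fourier inversion at \<open>b\<close>.\<close>
  then have "0 = (\<Sum>j<?n. g j * (1 / b) ^ j)"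
    by simp
  also have "\<dots> = (\<Sum>j<?n. \<Sum>x\<in>?K. of_int (f x) * (x / b) ^ j)"
    unfolding g_def by (simp add: sum_divide_distrib power_divide)
  also have "\<dots> = (\<Sum>x\<in>?K. \<Sum>j<?n. of_int (f x) * (x / b) ^ j)"
    by (rule sum.swap)
  also have "\<dots> = (\<Sum>x\<in>?K. if x = b then of_int (f b) * of_nat ?n else 0)"
  proof (rule sum.cong[OF refl])
    fix x assume x: "x \<in> ?K"
    show "(\<Sum>j<?n. of_int (f x) * (x / b) ^ j) = (if x = b then of_int (f b) * of_nat ?n else 0)"
    proof (cases "x = b")
      case False
      have "(x / b) ^ ?n = 1"
        using x b by (intro frob_fixed_power_card_minus_1) auto
      moreover have "x / b \<noteq> 1"
        using False b by auto
      ultimately have "(\<Sum>j<?n. (x / b) ^ j) = 0"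
        using geometric_sum[of "x / b" ?n] by simp
      then show ?thesis
        using False by (simp add: sum_distrib_left[symmetric])
    qed (use b in simp)
  qed
  also have "\<dots> = of_int (f b) * of_nat ?n"
    using b by simp
  \<comment> \<open>The group order \<open>Q - 1\<close> is \<open>- 1\<close> in the field, hence
    invertible, so \<open>f b\<close> itself is recovered.\<close>
  also have "of_nat ?n = (- 1 :: 'a)"
    using card_frob_fixed_eq_imp_pos[OF cardK] by (simp add: of_nat_diff Suc_leI)
  finally have "of_int (f b) = (0::'a)"
    by simp
  then show ?thesis
    by (simp only: of_int_eq_0_iff_char_dvd)
qed

text \<open>Once \<open>f = p * h\<close>, the convolution of \<open>h\<close> is that of
  \<open>f\<close> divided by \<open>p ^ 2\<close>. Each round lowers the odd exponent by 2 and
  gains one factor \<open>p\<close>; the last 1 of \<open>2 * v + 1\<close> pays for the base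
  case.\<close>

lemma convolution_power_dvd:
  fixes f :: "'a::finite_field \<Rightarrow> int"
  assumes cardK: "card (frob_fixed k :: 'a set) = CHAR('a) ^ k"
    and conv: "\<And>c. c \<in> frob_fixed k - {0} \<Longrightarrow>
      int CHAR('a) ^ (2 * v + 1) dvd (\<Sum>b\<in>frob_fixed k - {0}. f b * f (c / b))"
    and b: "b \<in> frob_fixed k - {0}"
  shows "int CHAR('a) ^ (v + 1) dvd f b"
  using conv b
proof (induction v arbitrary: f b)
  case 0
  then show ?case
    using convolution_dvd[OF cardK, of f b] by simp
next
  case (Suc v)
  let ?K = "frob_fixed k - {0} :: 'a set" and ?p = "int CHAR('a)"
  have p0: "?p \<noteq> 0" by simp
  have f: "?p dvd f b" if "b \<in> ?K" for b
  proof (rule convolution_dvd[OF cardK _ that])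
    fix c :: 'a assume "c \<in> ?K"
    show "?p dvd (\<Sum>b\<in>?K. f b * f (c / b))"
      by (rule dvd_trans[OF _ Suc.prems(1)[OF \<open>c \<in> ?K\<close>]]) simp
  qed
  define h where "h x = f x div ?p" for x
  have h: "f x = ?p * h x" if "x \<in> ?K" for x
    using f[OF that] by (simp add: h_def)
  have "?p ^ (v + 1) dvd h b"
  proof (rule Suc.IH)
    fix c :: 'a assume c: "c \<in> ?K"
    have "(\<Sum>b\<in>?K. f b * f (c / b)) = (\<Sum>b\<in>?K. ?p ^ 2 * (h b * h (c / b)))"
      using c by (intro sum.cong refl) (auto simp: h power2_eq_square)
    then have "(\<Sum>b\<in>?K. f b * f (c / b)) = ?p ^ 2 * (\<Sum>b\<in>?K. h b * h (c / b))"
      by (simp add: sum_distrib_left)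
    then have "?p ^ (2 * Suc v + 1) dvd ?p ^ 2 * (\<Sum>b\<in>?K. h b * h (c / b))"
      using Suc.prems(1)[OF c] by simp
    moreover have "?p ^ (2 * Suc v + 1) = ?p ^ 2 * ?p ^ (2 * v + 1)"
      by (simp add: power2_eq_square)
    ultimately show "?p ^ (2 * v + 1) dvd (\<Sum>b\<in>?K. h b * h (c / b))"
      using p0 by (simp only: dvd_mult_cancel_left power_eq_0_iff) simp
  qed (use Suc.prems in simp)
  then have "?p * ?p ^ (v + 1) dvd ?p * h b"
    by (intro mult_dvd_mono) auto
  then show ?case
    using h[OF Suc.prems(2)] by simp
qed

text \<open>Read contrapositively, this is the doubling bound for the minimal valuation. The
  convolution sees only nonzero elements; at \<open>b = 0\<close> the Weil sum vanishes.\<close>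

lemma rel_weil_sum_power_dvd_descend:
  fixes wK wL :: "'a::finite_field \<Rightarrow> int"
  assumes cardK: "card (frob_fixed k :: 'a set) = CHAR('a) ^ k"
    and cardL: "card (frob_fixed (2 * k) :: 'a set) = CHAR('a) ^ (2 * k)"
    and d: "d > 0" "coprime d (CHAR('a) ^ (2 * k) - 1)" "coprime d (CHAR('a) ^ k - 1)"
    and wK: "\<And>b. b \<in> frob_fixed k \<Longrightarrow> rel_weil_sum k d b = of_int (wK b)"
    and wL: "\<And>a. a \<in> frob_fixed (2 * k) \<Longrightarrow> rel_weil_sum (2 * k) d a = of_int (wL a)"
    and dvd: "\<And>a. a \<in> frob_fixed (2 * k) \<Longrightarrow> int CHAR('a) ^ (2 * v + 1) dvd wL a"
    and b: "b \<in> frob_fixed k"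
  shows "int CHAR('a) ^ (v + 1) dvd wK b"
proof (cases "b = 0")
  case True
  then have "(of_int (wK b) :: complex) = of_int 0"
    using rel_weil_sum_0[OF cardK d(1,3)] wK[OF b] by simp
  then show ?thesis
    by (simp only: of_int_eq_iff) simp
next
  case False
  show ?thesis
  proof (rule convolution_power_dvd[OF cardK])
    fix c :: 'a assume c: "c \<in> frob_fixed k - {0}"
    have "(of_int (\<Sum>a\<in>norm_fibre k c. wL a) :: complex) = (\<Sum>a\<in>norm_fibre k c. rel_weil_sum (2 * k) d a)"
      unfolding of_int_sum by (intro sum.cong refl wL[symmetric]) (auto simp: norm_fibre_def)
    also have "\<dots> = (\<Sum>b\<in>frob_fixed k - {0}. rel_weil_sum k d b * rel_weil_sum k d (c / b))"
      by (rule sum_rel_weil_sum_norm_fibre[OF cardK cardL d c])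
    also have "\<dots> = of_int (\<Sum>b\<in>frob_fixed k - {0}. wK b * wK (c / b))"
      unfolding of_int_sum of_int_mult using c by (intro sum.cong refl) (simp add: wK)
    finally have "(\<Sum>b\<in>frob_fixed k - {0}. wK b * wK (c / b)) = (\<Sum>a\<in>norm_fibre k c. wL a)"
      by (simp only: of_int_eq_iff)
    also have "int CHAR('a) ^ (2 * v + 1) dvd \<dots>"
      by (intro dvd_sum dvd) (simp add: norm_fibre_def)
    finally show "int CHAR('a) ^ (2 * v + 1) dvd (\<Sum>b\<in>frob_fixed k - {0}. wK b * wK (c / b))" .
  qed (use b False in simp)
qed

section \<open>Power sums, Frobenius twists and Niho exponents\<close>

lemma sum_power_frob_fixed:
  assumes card: "card (frob_fixed m :: 'a::finite_field set) = CHAR('a) ^ m"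
  shows "(\<Sum>x\<in>frob_fixed m - {0}. x ^ j) = (if (CHAR('a) ^ m - 1) dvd j then - 1 else (0::'a))"
proof -
  let ?n = "CHAR('a) ^ m - 1" and ?K = "frob_fixed m - {0} :: 'a set"
  have cardK: "card ?K = ?n"
    by (simp add: card)
  have p1: "x ^ ?n = 1" if "x \<in> ?K" for x
    using that by (intro frob_fixed_power_card_minus_1) auto
  show ?thesis
  proof (cases "?n dvd j")
    case True
    have "x ^ j = 1" if "x \<in> ?K" for x
      using p1[OF that] True by (auto simp: power_mult elim!: dvdE)
    then have "(\<Sum>x\<in>?K. x ^ j) = of_nat ?n"
      using cardK by simp
    also have "\<dots> = - 1"
      using card_frob_fixed_eq_imp_pos[OF card] by (simp add: of_nat_diff Suc_leI)
    finally show ?thesis using True by simp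
  next
    case False
    \<comment> \<open>Reducing \<open>j\<close> modulo the group order leaves an exponent
      \<open>r\<close> so small that \<open>x ^ r = 1\<close> has too few roots, so some
      \<open>y\<close> has \<open>y ^ j\<close> other than 1. Scaling by this \<open>y\<close>
      annihilates the sum.\<close>
    define r where "r = j mod ?n"
    have n0: "?n > 0"
      using CHAR_power_gt_1[OF card_frob_fixed_eq_imp_pos[OF card], where 'a='a] by simp
    have r: "0 < r" "r < ?n"
      using False n0 unfolding r_def by (auto simp: dvd_eq_mod_eq_0)
    have "card {x::'a. x ^ r = poly [:1:] x} \<le> r"
      using r by (intro card_power_roots_le) simp
    then have "card {x::'a. x ^ r = poly [:1:] x} < card ?K"
      using r cardK by simp
    then have "\<not> ?K \<subseteq> {x. x ^ r = poly [:1:] x}"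
      by (meson card_mono finite linorder_not_le)
    then obtain y where y: "y \<in> ?K" "y ^ r \<noteq> 1"
      by auto
    have "y ^ j = y ^ (?n * (j div ?n) + r)"
      by (simp add: r_def)
    also have "\<dots> = y ^ r"
      unfolding power_add power_mult p1[OF y(1)] by simp
    finally have yj: "y ^ j \<noteq> 1"
      using y by simp
    have "(\<Sum>x\<in>?K. x ^ j) = (\<Sum>x\<in>?K. (y * x) ^ j)"
      by (rule sum.reindex_bij_witness[of _ "\<lambda>x. y * x" "\<lambda>x. x / y"]) (use y in auto)
    also have "\<dots> = y ^ j * (\<Sum>x\<in>?K. x ^ j)"
      by (simp add: power_mult_distrib sum_distrib_left)
    finally have "(1 - y ^ j) * (\<Sum>x\<in>?K. x ^ j) = 0"
      by (simp add: algebra_simps)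
    then show ?thesis
      using yj False by simp
  qed
qed

text \<open>Compare the coefficients of \<open>x ^ d\<close> in \<open>Tr (x ^ d) = Tr (a x)\<close>, by summing against \<open>x ^ (- d)\<close>.\<close>
lemma trace_identity_imp_degenerate:
  assumes card: "card (frob_fixed m :: 'a::finite_field set) = CHAR('a) ^ m"
    and d: "coprime d (CHAR('a) ^ m - 1)"
    and tr: "\<And>x. x \<in> frob_fixed m \<Longrightarrow> rel_trace m (x ^ d - a * x) = (0::'a)"
  shows "\<exists>i. [d = CHAR('a) ^ i] (mod (CHAR('a) ^ m - 1))"
proof (rule ccontr)
  let ?n = "CHAR('a) ^ m - 1" and ?K = "frob_fixed m - {0} :: 'a set" and ?p = "CHAR('a)"
  assume nd: "\<nexists>i. [d = ?p ^ i] (mod ?n)"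
  have m0: "m > 0"
    by (rule card_frob_fixed_eq_imp_pos[OF card])
  \<comment> \<open>\<open>e\<close> is congruent to \<open>- d\<close> modulo \<open>?n\<close>, a
    natural exponent standing for \<open>x ^ (- d)\<close>.\<close>
  define e where "e = (?n - 1) * d"
  have n0: "?n > 0"
    using CHAR_power_gt_1[OF m0, where 'a='a] by simp
  have de: "d + e = ?n * d"
    unfolding e_def using n0 by (metis Suc_pred' mult_Suc)
  have iff: "?n dvd j + e \<longleftrightarrow> [j = d] (mod ?n)" for j
  proof -
    have "?n dvd j + e \<longleftrightarrow> [j + e = d + e] (mod ?n)"
      unfolding de by (simp add: Cong.cong_def dvd_eq_mod_eq_0)
    also have "\<dots> \<longleftrightarrow> [j = d] (mod ?n)"
      by (rule cong_add_rcancel_nat)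
    finally show ?thesis .
  qed
  \<comment> \<open>Nondegeneracy removes every term coming from \<open>a * x\<close>.\<close>
  have 1: "(\<Sum>x\<in>?K. x ^ (?p ^ i + e)) = 0" for i
    unfolding sum_power_frob_fixed[OF card] iff using nd by (auto simp: cong_sym_eq)
  \<comment> \<open>From \<open>x ^ d\<close> only \<open>i = 0\<close> survives: \<open>d\<close>
    can be cancelled, and for \<open>i < m\<close> the power \<open>p ^ i\<close> is congruent to 1
    only if \<open>i = 0\<close>.\<close>
  have 2: "(\<Sum>x\<in>?K. x ^ (d * ?p ^ i + e)) = (if i = 0 then - 1 else 0)" if "i < m" for i
  proof -
    have "[d * ?p ^ i = d] (mod ?n) \<longleftrightarrow> [?p ^ i = 1] (mod ?n)"
      using cong_mult_lcancel_nat[OF d, of "?p ^ i" 1] by simp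
    also have "\<dots> \<longleftrightarrow> i = 0"
    proof
      assume c: "[?p ^ i = 1] (mod ?n)"
      show "i = 0"
      proof (rule ccontr)
        assume "i \<noteq> 0"
        then have "1 < ?p ^ i"
          by (intro CHAR_power_gt_1) simp
        moreover have "?p ^ i < ?p ^ m"
          using that CHAR_ge_2[where 'a='a] by (intro power_strict_increasing) auto
        moreover have "?n dvd ?p ^ i - 1"
          using c \<open>1 < ?p ^ i\<close> by (simp add: cong_altdef_nat)
        ultimately show False
          by (auto dest: dvd_imp_le)
      qed
    qed simp
    finally show ?thesis
      unfolding sum_power_frob_fixed[OF card] iff by simp
  qed
  have "0 = (\<Sum>x\<in>?K. x ^ e * rel_trace m (x ^ d - a * x))"
    by (simp add: tr)
  also have "\<dots> = (\<Sum>x\<in>?K. \<Sum>i<m. x ^ (d * ?p ^ i + e) - a ^ (?p ^ i) * x ^ (?p ^ i + e))"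
    unfolding rel_trace_def sum_distrib_left
    by (intro sum.cong refl) (simp add: frob_diff power_mult_distrib power_add power_mult algebra_simps)
  also have "\<dots> = (\<Sum>i<m. \<Sum>x\<in>?K. x ^ (d * ?p ^ i + e) - a ^ (?p ^ i) * x ^ (?p ^ i + e))"
    by (rule sum.swap)
  also have "\<dots> = (\<Sum>i<m. if i = 0 then - 1 else 0)"
    by (intro sum.cong refl) (simp add: sum_subtractf sum_distrib_left[symmetric] 1 2)
  also have "\<dots> = - 1"
    using m0 by simp
  finally show False by simp
qed

text \<open>The character does not see Frobenius, so the factor containing \<open>x ^ d\<close> may
  be raised to a power of \<open>p\<close> while the one with \<open>a * x\<close> stays.\<close>

lemma rel_weil_sum_frob_twist:
  assumes "a \<in> frob_fixed k"
  shows "rel_weil_sum k (d * CHAR('a::finite_field) ^ i) a = rel_weil_sum k d (a::'a)"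
  unfolding rel_weil_sum_altdef[OF assms] power_mult
  by (intro sum.cong refl) (simp add: add_char_frob)

text \<open>Averaging \<open>x \<mapsto> x y\<close> over \<open>y\<close> in \<open>K\<close>: since \<open>(x y) ^ d = x ^ d y\<close>, the inner sum detects the zeros
  of the relative trace of \<open>x ^ d - a x\<close>.\<close>
lemma niho_rel_weil_sum:
  assumes cardK: "card (frob_fixed k :: 'a::finite_field set) = CHAR('a) ^ k"
    and cardL: "card (frob_fixed (2 * k) :: 'a set) = CHAR('a) ^ (2 * k)"
    and d: "d > 0" "\<And>y::'a. y \<in> frob_fixed k \<Longrightarrow> y ^ d = y"
    and a: "a \<in> frob_fixed (2 * k)"
    and w: "rel_weil_sum (2 * k) d (a::'a) = of_int w"
  obtains u where "w = int (CHAR('a) ^ k) * u" "u \<ge> - 1"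
proof -
  let ?K = "frob_fixed k :: 'a set" and ?L = "frob_fixed (2 * k) :: 'a set"
  let ?\<psi> = "add_char (2 * k) :: 'a \<Rightarrow> complex"
  define Q where "Q = CHAR('a) ^ k"
  have Q1: "Q > 1"
    unfolding Q_def by (rule CHAR_power_gt_1[OF card_frob_fixed_eq_imp_pos[OF cardK]])
  have q: "CHAR('a) ^ (2 * k) = Q * Q"
    by (simp add: Q_def power_add mult_2)
  have KL: "y \<in> ?L" if "y \<in> ?K" for y
    using that by (rule frob_fixed_double)
  define z where "z x = x ^ d - a * x" for x
  have z_in: "z x \<in> ?L" if "x \<in> ?L" for x
    using that a by (simp add: z_def)
  define M where "M = card {x\<in>?L - {0}. quad_trace k (z x) = 0}"
  have z_mult: "z (x * y) = y * z x" if "y \<in> ?K" for x y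
    using d(2)[OF that] by (simp add: z_def power_mult_distrib algebra_simps)
  have \<psi>: "?\<psi> (z (x * y)) = add_char k (quad_trace k (z x) * y)" if "y \<in> ?K" for x y
  proof -
    have "quad_trace k (y * z x) = quad_trace k (z x) * y"
      using that by (simp add: quad_trace_def power_mult_distrib frob_fixed_def algebra_simps)
    then show ?thesis
      by (simp add: z_mult[OF that] add_char_quad_trace)
  qed
  have W: "(\<Sum>x\<in>?L - {0}. ?\<psi> (z x)) = of_int (w - 1)"
    using w d(1) unfolding rel_weil_sum_def
    by (subst (asm) sum.remove[of _ 0]) (auto simp: z_def power_0_left algebra_simps)
  have "(\<Sum>y\<in>?K. \<Sum>x\<in>?L - {0}. ?\<psi> (z (x * y))) =
      (\<Sum>x\<in>?L - {0}. ?\<psi> (z (x * 0))) + (\<Sum>y\<in>?K - {0}. \<Sum>x\<in>?L - {0}. ?\<psi> (z (x * y)))"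
    by (subst sum.remove[of _ 0]) auto
  also have "(\<Sum>x\<in>?L - {0}. ?\<psi> (z (x * 0))) = of_nat (Q * Q - 1)"
    using d(1) by (simp add: z_def power_0_left cardL q)
  also have "(\<Sum>y\<in>?K - {0}. \<Sum>x\<in>?L - {0}. ?\<psi> (z (x * y))) = (\<Sum>y\<in>?K - {0}. of_int (w - 1))"
  proof (rule sum.cong[OF refl])
    fix y assume y: "y \<in> ?K - {0}"
    have "(\<Sum>x\<in>?L - {0}. ?\<psi> (z (x * y))) = (\<Sum>x\<in>?L - {0}. ?\<psi> (z x))"
      by (rule sum.reindex_bij_witness[of _ "\<lambda>x. x / y" "\<lambda>x. x * y"]) (use y KL in auto)
    then show "(\<Sum>x\<in>?L - {0}. ?\<psi> (z (x * y))) = of_int (w - 1)"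
      by (simp only: W)
  qed
  also have "\<dots> = of_nat (Q - 1) * of_int (w - 1)"
    by (simp add: cardK flip: Q_def)
  finally have lhs: "(\<Sum>y\<in>?K. \<Sum>x\<in>?L - {0}. ?\<psi> (z (x * y))) = of_nat (Q * Q - 1) + of_nat (Q - 1) * of_int (w - 1)" .
  have "(\<Sum>y\<in>?K. \<Sum>x\<in>?L - {0}. ?\<psi> (z (x * y))) = (\<Sum>x\<in>?L - {0}. \<Sum>y\<in>?K. ?\<psi> (z (x * y)))"
    by (rule sum.swap)
  also have "\<dots> = (\<Sum>x\<in>?L - {0}. \<Sum>y\<in>?K. add_char k (quad_trace k (z x) * y))"
    by (intro sum.cong refl \<psi>)
  also have "\<dots> = (\<Sum>x\<in>?L - {0}. if quad_trace k (z x) = 0 then of_nat Q else 0)"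
    unfolding Q_def by (intro sum.cong refl sum_add_char cardK quad_trace_in z_in) auto
  also have "\<dots> = of_nat (Q * M)"
    by (subst sum.inter_filter[symmetric]) (auto simp: M_def)
  finally have "(of_int (int (Q * Q - 1) + int (Q - 1) * (w - 1)) :: complex) = of_int (int (Q * M))"
    unfolding lhs by simp
  then have "int (Q * Q - 1) + int (Q - 1) * (w - 1) = int (Q * M)"
    by (simp only: of_int_eq_iff)
  moreover have "int (Q * Q - 1) = int Q * int Q - 1" "int (Q - 1) = int Q - 1"
    using Q1 by (simp_all add: of_nat_diff)
  \<comment> \<open>The left side collects to \<open>(Q - 1) * (w + Q)\<close>. As \<open>Q\<close>
    is coprime to \<open>Q - 1\<close>, it divides \<open>w\<close>, and nonnegativity of
    \<open>M\<close> bounds the quotient below by -1.\<close>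
  ultimately have eq: "(int Q - 1) * (w + int Q) = int Q * int M"
    by (simp add: algebra_simps)
  then have "int Q dvd (int Q - 1) * (w + int Q)"
    by simp
  moreover have "coprime (int Q) (int Q - 1)"
    using dvd_diff[of _ "int Q" "int Q - 1"] by (intro coprimeI) auto
  ultimately have "int Q dvd w + int Q"
    by (simp add: coprime_dvd_mult_right_iff)
  then have "int Q dvd w"
    by simp
  then obtain u where u: "w = int Q * u"
    by (rule dvdE)
  have "int Q * ((int Q - 1) * (u + 1)) = int Q * int M"
    using eq by (simp add: u algebra_simps)
  then have "(int Q - 1) * (u + 1) = int M"
    using Q1 by simp
  then have "(int Q - 1) * (u + 1) \<ge> 0"
    by simp
  then have "u + 1 \<ge> 0"
    using Q1 by (simp add: zero_le_mult_iff)
  then show ?thesis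
    using that[of u] u by (simp add: Q_def)
qed

text \<open>If \<open>p\<close> divided every quotient \<open>W(a) / Q\<close>, all \<open>W(a)\<close> would be nonnegative, and the first two
  power moments would force a single nonzero value \<open>W(a) = q\<close>.\<close>
lemma niho_rel_weil_sum_not_dvd:
  fixes w :: "'a::finite_field \<Rightarrow> int"
  assumes cardK: "card (frob_fixed k :: 'a set) = CHAR('a) ^ k"
    and cardL: "card (frob_fixed (2 * k) :: 'a set) = CHAR('a) ^ (2 * k)"
    and d: "d > 0" "\<And>y::'a. y \<in> frob_fixed k \<Longrightarrow> y ^ d = y" "coprime d (CHAR('a) ^ (2 * k) - 1)"
    and w: "\<And>a. a \<in> frob_fixed (2 * k) \<Longrightarrow> rel_weil_sum (2 * k) d a = of_int (w a)"
    and nd: "\<nexists>i. [d = CHAR('a) ^ i] (mod (CHAR('a) ^ (2 * k) - 1))"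
  shows "\<exists>a\<in>frob_fixed (2 * k). \<not> int CHAR('a) ^ (k + 1) dvd w a"
proof (rule ccontr)
  let ?L = "frob_fixed (2 * k) :: 'a set" and ?p = "CHAR('a)"
  let ?q = "int (?p ^ (2 * k))"
  assume "\<not> (\<exists>a\<in>?L. \<not> int ?p ^ (k + 1) dvd w a)"
  then have dvd: "int ?p ^ (k + 1) dvd w a" if "a \<in> ?L" for a
    using that by blast
  have nonneg: "w a \<ge> 0" if a: "a \<in> ?L" for a
  proof -
    obtain u where u: "w a = int (?p ^ k) * u" "u \<ge> - 1"
      by (rule niho_rel_weil_sum[OF cardK cardL d(1,2) a w[OF a]])
    have "int ?p ^ k * int ?p dvd int ?p ^ k * u"
      using dvd[OF a] by (simp add: u mult.commute)
    then have "int ?p dvd u"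
      by (simp only: dvd_mult_cancel_left) simp
    \<comment> \<open>Divisibility by \<open>p\<close> excludes the only negative value that the
      Niho bound allows.\<close>
    then have "u \<noteq> - 1"
      using CHAR_ge_2[where 'a='a] by (auto dest: zdvd_imp_le)
    then show ?thesis
      using u by simp
  qed
  have "(of_int (\<Sum>a\<in>?L. w a) :: complex) = of_int ?q"
    using sum_rel_weil_sum[OF cardL d(1)] by (simp add: w)
  then have sum1: "(\<Sum>a\<in>?L. w a) = ?q"
    by (simp only: of_int_eq_iff)
  have "(of_int (\<Sum>a\<in>?L. w a * w a) :: complex) = of_int (?q ^ 2)"
    using sum_norm_rel_weil_sum[OF cardL, of d] by (simp add: w)
  then have sum2: "(\<Sum>a\<in>?L. w a * w a) = ?q ^ 2"
    by (simp only: of_int_eq_iff)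
  \<comment> \<open>By the two moments the nonnegative terms \<open>w a * (?q - w a)\<close> have
    total 0, so every \<open>w a\<close> is 0 or \<open>?q\<close>.\<close>
  have "(\<Sum>a\<in>?L. w a * (?q - w a)) = 0"
    by (simp add: right_diff_distrib sum_subtractf sum2 power2_eq_square sum1 flip: sum_distrib_right)
  moreover have "w a * (?q - w a) \<ge> 0" if a: "a \<in> ?L" for a
  proof -
    have "w a \<le> (\<Sum>a\<in>?L. w a)"
      by (rule member_le_sum[OF a]) (use nonneg in auto)
    then show ?thesis
      using nonneg[OF a] by (simp add: sum1)
  qed
  ultimately have zero: "w a * (?q - w a) = 0" if "a \<in> ?L" for a
    using that by (simp add: sum_nonneg_eq_0_iff)
  have "\<exists>a\<in>?L. w a \<noteq> 0"
  proof (rule ccontr)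
    assume "\<not> (\<exists>a\<in>?L. w a \<noteq> 0)"
    then show False using sum1 by simp
  qed
  then obtain a where a: "a \<in> ?L" "w a = ?q"
    using zero by force
  have "(\<Sum>x\<in>?L. add_char (2 * k) (x ^ d - a * x)) = of_int ?q"
    using w[OF a(1)] a(2) by (simp add: rel_weil_sum_def)
  \<comment> \<open>As many numbers of absolute value 1 as their sum indicates must all equal 1;
    comparing real parts shows it.\<close>
  then have "(\<Sum>x\<in>?L. Re (add_char (2 * k) (x ^ d - a * x))) = real (card ?L)"
    unfolding cardL by (metis Re_complex_of_real Re_sum of_int_of_nat_eq of_real_of_nat_eq)
  then have "(\<Sum>x\<in>?L. 1 - Re (add_char (2 * k) (x ^ d - a * x))) = 0"
    by (simp add: sum_subtractf)
  moreover have "1 - Re (add_char (2 * k) y) \<ge> 0" for y :: 'a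
    using complex_Re_le_cmod[of "add_char (2 * k) y"] by simp
  ultimately have Re1: "Re (add_char (2 * k) (x ^ d - a * x)) = 1" if "x \<in> ?L" for x
    using that by (simp add: sum_nonneg_eq_0_iff)
  have "rel_trace (2 * k) (x ^ d - a * x) = 0" if x: "x \<in> ?L" for x
  proof -
    have "(Re (add_char (2 * k) (x ^ d - a * x)))\<^sup>2 + (Im (add_char (2 * k) (x ^ d - a * x)))\<^sup>2 = 1"
      by (simp flip: cmod_power2)
    then have "add_char (2 * k) (x ^ d - a * x) = 1"
      using Re1[OF x] by (simp add: complex_eq_iff)
    then show ?thesis
      using add_char_eq_1_iff[of "x ^ d - a * x" "2 * k"] x a(1) by simp
  qed
  from trace_identity_imp_degenerate[OF cardL d(3) this] nd show False
    by blast
qed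


section \<open>The tower of quadratic extensions\<close>

lemma CHAR_power_cong_1: "[CHAR('a::finite_field) ^ (k * j) = 1] (mod (CHAR('a) ^ k - 1))"
proof -
  have "[CHAR('a) ^ k = 1] (mod (CHAR('a) ^ k - 1))"
    by (simp add: cong_altdef_nat Suc_leI)
  from cong_pow[OF this, of j] show ?thesis
    by (simp add: power_mult)
qed

text \<open>Multiplying \<open>d\<close> by a power of \<open>p\<close> does not change the Weil sums, so \<open>d\<close> may be taken to be \<open>1\<close>
  modulo \<open>Q - 1\<close>.\<close>
lemma degenerate_normalize:
  assumes "[d = CHAR('a::finite_field) ^ j] (mod (CHAR('a) ^ k - 1))" "k > 0" "d > 0" "y \<in> frob_fixed k"
  shows "y ^ (d * CHAR('a) ^ (j * (k - 1))) = (y::'a)"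
proof -
  have "j + j * (k - 1) = k * j"
    using assms(2) by (cases k) auto
  then have "CHAR('a) ^ j * CHAR('a) ^ (j * (k - 1)) = CHAR('a) ^ (k * j)"
    by (simp only: power_add[symmetric])
  then have "[d * CHAR('a) ^ (j * (k - 1)) = CHAR('a) ^ (k * j)] (mod (CHAR('a) ^ k - 1))"
    using cong_scalar_right[OF assms(1)] by metis
  then have "[d * CHAR('a) ^ (j * (k - 1)) = 1] (mod (CHAR('a) ^ k - 1))"
    using CHAR_power_cong_1 by (rule cong_trans)
  then have "y ^ (d * CHAR('a) ^ (j * (k - 1))) = y ^ 1"
    using assms by (intro frob_fixed_power_cong) auto
  then show ?thesis by simp
qed

text \<open>As \<open>p ^ m\<close> is congruent to 1, \<open>p ^ i\<close> has the inverse
  \<open>p ^ (i * (m - 1))\<close>. Nondegeneracy therefore survives the normalization.\<close>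

lemma degenerate_mult_power:
  assumes "[d * CHAR('a::finite_field) ^ i = CHAR('a) ^ t] (mod (CHAR('a) ^ m - 1))" "m > 0"
  shows "[d = CHAR('a) ^ (t + i * (m - 1))] (mod (CHAR('a) ^ m - 1))"
proof -
  have "i + i * (m - 1) = m * i"
    using assms(2) by (cases m) auto
  then have eq: "CHAR('a) ^ i * CHAR('a) ^ (i * (m - 1)) = CHAR('a) ^ (m * i)"
    by (simp only: power_add[symmetric])
  have "[d * 1 = d * CHAR('a) ^ (m * i)] (mod (CHAR('a) ^ m - 1))"
    by (intro cong_scalar_left cong_sym[OF CHAR_power_cong_1])
  also have "d * CHAR('a) ^ (m * i) = d * CHAR('a) ^ i * CHAR('a) ^ (i * (m - 1))"
    by (simp only: eq mult.assoc)
  also have "[\<dots> = CHAR('a) ^ t * CHAR('a) ^ (i * (m - 1))] (mod (CHAR('a) ^ m - 1))"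
    using assms(1) by (rule cong_scalar_right)
  finally show ?thesis
    by (simp add: power_add)
qed

lemma coprime_CHAR_power_minus_1:
  assumes "m > 0"
  shows "coprime (CHAR('a::finite_field) ^ i) (CHAR('a) ^ m - 1)"
proof -
  have "coprime (CHAR('a) ^ m) (CHAR('a) ^ m - 1)"
    by (metis CHAR_pos coprime_diff_one_right_nat zero_less_power)
  then show ?thesis
    using assms by simp
qed

text \<open>A Frobenius twist makes a degenerate exponent act as the identity on
  \<open>frob_fixed k\<close>, where the Niho divisibility applies. This yields the lower bound in
  the equality case.\<close>

lemma degenerate_rel_weil_sum_dvd:
  assumes cardK: "card (frob_fixed k :: 'a::finite_field set) = CHAR('a) ^ k"
    and cardL: "card (frob_fixed (2 * k) :: 'a set) = CHAR('a) ^ (2 * k)"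
    and d: "d > 0" "[d = CHAR('a) ^ j] (mod (CHAR('a) ^ k - 1))"
    and a: "a \<in> frob_fixed (2 * k)" and w: "rel_weil_sum (2 * k) d (a::'a) = of_int w"
  shows "int CHAR('a) ^ k dvd w"
proof -
  let ?e = "d * CHAR('a) ^ (j * (k - 1))"
  have "?e > 0"
    using d(1) by simp
  moreover have "y ^ ?e = y" if "y \<in> frob_fixed k" for y :: 'a
    using degenerate_normalize[OF d(2) card_frob_fixed_eq_imp_pos[OF cardK] d(1) that] .
  moreover have "rel_weil_sum (2 * k) ?e a = of_int w"
    using rel_weil_sum_frob_twist[OF a] w by metis
  ultimately obtain u where "w = int (CHAR('a) ^ k) * u"
    using niho_rel_weil_sum[OF cardK cardL _ _ a] by metis
  then show ?thesis by simp
qed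

text \<open>The same twist at the step where degeneracy is lost; it starts the upper bound.\<close>

lemma degenerate_rel_weil_sum_not_dvd:
  fixes w :: "'a::finite_field \<Rightarrow> int"
  assumes cardK: "card (frob_fixed k :: 'a set) = CHAR('a) ^ k"
    and cardL: "card (frob_fixed (2 * k) :: 'a set) = CHAR('a) ^ (2 * k)"
    and d: "d > 0" "coprime d (CHAR('a) ^ (2 * k) - 1)" "[d = CHAR('a) ^ j] (mod (CHAR('a) ^ k - 1))"
    and nd: "\<nexists>i. [d = CHAR('a) ^ i] (mod (CHAR('a) ^ (2 * k) - 1))"
    and w: "\<And>a. a \<in> frob_fixed (2 * k) \<Longrightarrow> rel_weil_sum (2 * k) d a = of_int (w a)"
  shows "\<exists>a\<in>frob_fixed (2 * k). \<not> int CHAR('a) ^ (k + 1) dvd w a"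
proof -
  let ?i = "j * (k - 1)"
  let ?e = "d * CHAR('a) ^ ?i"
  have k0: "k > 0" "2 * k > 0"
    using card_frob_fixed_eq_imp_pos[OF cardK] by auto
  show ?thesis
  proof (rule niho_rel_weil_sum_not_dvd[OF cardK cardL])
    show "?e > 0"
      using d(1) by simp
    show "y ^ ?e = y" if "y \<in> frob_fixed k" for y :: 'a
      using degenerate_normalize[OF d(3) k0(1) d(1) that] .
    show "coprime ?e (CHAR('a) ^ (2 * k) - 1)"
      using d(2) coprime_CHAR_power_minus_1[OF k0(2), of ?i, where 'a='a] by (simp add: coprime_mult_left_iff)
    show "rel_weil_sum (2 * k) ?e a = of_int (w a)" if "a \<in> frob_fixed (2 * k)" for a
      using rel_weil_sum_frob_twist[OF that] w[OF that] by metis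
    show "\<nexists>i. [?e = CHAR('a) ^ i] (mod (CHAR('a) ^ (2 * k) - 1))"
      using nd degenerate_mult_power[OF _ k0(2), where 'a='a] by blast
  qed
qed

text \<open>The facts are known for the whole field, so the induction descends from \<open>s\<close>
  by halving the degree.\<close>

lemma tower_card_coprime:
  assumes "abs_degree TYPE('a::finite_field) = 2 ^ s" "coprime d (CARD('a) - 1)" "i \<le> s"
  shows "card (frob_fixed (2 ^ i) :: 'a set) = CHAR('a) ^ (2 ^ i) \<and> coprime d (CHAR('a) ^ (2 ^ i) - 1)"
  using assms(3)
proof (induction rule: inc_induct)
  case base
  show ?case
    using assms(1,2) frob_fixed_abs_degree[where 'a='a] CARD_eq_CHAR_power[where 'a='a] by metis
next
  case (step i)
  let ?Q = "CHAR('a) ^ (2 ^ i)"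
  have eq: "(2::nat) ^ Suc i = 2 * 2 ^ i"
    by simp
  have "card (frob_fixed (2 ^ i) :: 'a set) = ?Q"
    by (rule card_frob_fixed_half) (use step.IH eq in auto)
  moreover have "CHAR('a) ^ (2 ^ Suc i) - 1 = (?Q - 1) * (?Q + 1)"
    by (simp add: power_even_eq power2_eq_square algebra_simps)
  then have "coprime d (?Q - 1)"
    using step.IH by (simp only: coprime_mult_right_iff)
  ultimately show ?case ..
qed

lemma weil_sum_eq_rel_weil_sum: "weil_sum d a = rel_weil_sum (abs_degree TYPE('a)) d (a::'a::finite_field)"
  unfolding weil_sum_def rel_weil_sum_def frob_fixed_abs_degree canonical_char_def add_char_def
    zeta_power abs_trace_def rel_trace_def ..

theorem theorem4p1:
  fixes d s :: nat
  assumes "s \<ge> 1"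
    and "abs_degree TYPE('a::finite_field) = 2 ^ s"
    and "d > 0"
    and "coprime d (CARD('a) - 1)"
    and "\<not> degenerate_over d (UNIV :: 'a set)"
    and "degenerate_over d (prime_subfield :: 'a set)"
  shows "min_val TYPE('a) d \<le> ereal (real (abs_degree TYPE('a)) / 2) \<and>
    (\<forall>K :: 'a set. subfield K ring_of_type_algebra \<and> real (card K) = sqrt (real CARD('a)) \<and>
       degenerate_over d K \<longrightarrow>
       min_val TYPE('a) d = ereal (real (abs_degree TYPE('a)) / 2))"
proof -
  let ?p = "CHAR('a)"
  have card: "card (frob_fixed (2 ^ i) :: 'a set) = ?p ^ (2 ^ i)"
    and coprime: "coprime d (?p ^ (2 ^ i) - 1)" if "i \<le> s" for i
    using tower_card_coprime[OF assms(2,4) that] by auto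
  have CARD: "CARD('a) = ?p ^ (2 ^ s)"
    using CARD_eq_CHAR_power[where 'a='a] assms(2) by simp
  \<comment> \<open>Degeneracy over the level of order \<open>p ^ (2 ^ i)\<close>. It holds at the
    bottom and fails at the top, so it is lost at some step.\<close>
  define D where "D i \<longleftrightarrow> (\<exists>j. [d = ?p ^ j] (mod (?p ^ (2 ^ i) - 1)))" for i
  have D0: "D 0"
    using assms(6) card_frob_fixed_1[where 'a='a]
    by (simp add: D_def degenerate_over_def prime_subfield_eq)
  have Ds: "\<not> D s"
    using assms(5) by (simp add: D_def degenerate_over_def CARD)
  have d_prime: "c ^ d = c" if c: "c \<in> frob_fixed 1" for c :: 'a
  proof -
    obtain j where "[d = ?p ^ j] (mod (?p ^ 1 - 1))"
      using D0 by (auto simp: D_def)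
    then have "c ^ d = c ^ (?p ^ j)"
      using c assms(3) by (intro frob_fixed_power_cong) auto
    then show ?thesis
      using frob_fixed_1_fixed[OF c] by simp
  qed
  define w where "w i a = (THE m. rel_weil_sum (2 ^ i) d (a::'a) = of_int m)" for i a
  have w: "rel_weil_sum (2 ^ i) d a = of_int (w i a)" if "i \<le> s" "a \<in> frob_fixed (2 ^ i)" for i a
  proof -
    have "rel_weil_sum (2 ^ i) d a \<in> \<int>"
      using card[OF that(1)] d_prime that(2) by (rule rel_weil_sum_int)
    then obtain m where m: "rel_weil_sum (2 ^ i) d a = of_int m"
      by (elim Ints_cases)
    then show ?thesis
      unfolding w_def by simp
  qed
  have "\<exists>i<s. D i \<and> \<not> D (Suc i)"
  proof (rule ccontr)
    assume *: "\<not> (\<exists>i<s. D i \<and> \<not> D (Suc i))"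
    have "i \<le> s \<Longrightarrow> D i" for i
      by (induction i) (use D0 * in auto)
    then show False using Ds by blast
  qed
  then obtain i where i: "i < s" "D i" "\<not> D (Suc i)"
    by blast
  \<comment> \<open>Some value at level \<open>Suc i\<close> has valuation at most
    \<open>2 ^ i\<close>, half the degree of that level.\<close>
  define P where "P i \<longleftrightarrow> (\<exists>a\<in>frob_fixed (2 ^ Suc i). \<not> int ?p ^ (2 ^ i + 1) dvd w (Suc i) a)" for i
  have P_start: "P i"
  proof -
    obtain j where j: "[d = ?p ^ j] (mod (?p ^ (2 ^ i) - 1))"
      using i(2) by (auto simp: D_def)
    have "\<exists>a\<in>frob_fixed (2 * 2 ^ i). \<not> int ?p ^ (2 ^ i + 1) dvd w (Suc i) a"
    proof (rule degenerate_rel_weil_sum_not_dvd[OF _ _ assms(3) _ j])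
    qed (use i card[of i] card[of "Suc i"] coprime[of "Suc i"] w[of "Suc i"] in \<open>auto simp: D_def\<close>)
    then show ?thesis
      by (simp add: P_def)
  qed
  have P_step: "P (Suc m)" if m: "P m" "Suc (Suc m) \<le> s" for m
  proof (rule ccontr)
    assume "\<not> P (Suc m)"
    \<comment> \<open>Because \<open>2 ^ Suc m = 2 * 2 ^ m\<close>, the descent applies with
      \<open>v = 2 ^ m\<close>.\<close>
    then have *: "int ?p ^ (2 * 2 ^ m + 1) dvd w (Suc (Suc m)) a" if "a \<in> frob_fixed (2 * 2 ^ Suc m)" for a
      using that unfolding P_def by simp
    have "int ?p ^ (2 ^ m + 1) dvd w (Suc m) b" if b: "b \<in> frob_fixed (2 ^ Suc m)" for b
    proof (rule rel_weil_sum_power_dvd_descend[OF _ _ assms(3) _ _ _ _ * b])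
      show "rel_weil_sum (2 ^ Suc m) d x = of_int (w (Suc m) x)" if "x \<in> frob_fixed (2 ^ Suc m)" for x
        using that m(2) by (intro w) auto
      show "rel_weil_sum (2 * 2 ^ Suc m) d x = of_int (w (Suc (Suc m)) x)" if "x \<in> frob_fixed (2 * 2 ^ Suc m)" for x
        using w[of "Suc (Suc m)" x] that m(2) by simp
    qed (use m(2) card[of "Suc m"] card[of "Suc (Suc m)"] coprime[of "Suc m"] coprime[of "Suc (Suc m)"] in auto)
    then show False
      using m(1) by (simp add: P_def)
  qed
  have s1: "Suc (s - 1) = s"
    using assms(1) by simp
  have "P (s - 1)"
  proof -
    have "i \<le> s - 1"
      using i(1) by simp
    then show ?thesis
    proof (induction rule: dec_induct)
      case (step m)
      then show ?case
        by (intro P_step) auto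
    qed (rule P_start)
  qed
  then obtain a where a: "\<not> int ?p ^ (2 ^ (s - 1) + 1) dvd w s a"
    unfolding P_def s1 by blast
  have half: "real (abs_degree TYPE('a)) / 2 = real (2 ^ (s - 1))"
    unfolding assms(2) using s1 by (metis nonzero_mult_div_cancel_left of_nat_mult of_nat_numeral power_Suc zero_neq_numeral)
  have weil: "weil_sum d x = of_int (w s x)" for x :: 'a
    unfolding weil_sum_eq_rel_weil_sum assms(2)
    by (rule w) (use frob_fixed_abs_degree[where 'a='a] assms(2) in auto)
  have p_unit: "\<not> is_unit (int ?p)"
    using CHAR_ge_2[where 'a='a] by simp
  have vals: "val ?p (weil_sum d x) = (if w s x = 0 then \<infinity> else ereal (real (multiplicity (int ?p) (w s x))))" for x :: 'a
    unfolding weil by (cases "w s x = 0") (simp add: val_def, simp add: val_of_int)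
  have upper: "min_val TYPE('a) d \<le> ereal (real (abs_degree TYPE('a)) / 2)"
  proof -
    have "min_val TYPE('a) d \<le> val ?p (weil_sum d a)"
      unfolding min_val_def by (rule Min_le) auto
    also have "\<dots> = ereal (real (multiplicity (int ?p) (w s a)))"
      \<comment> \<open>The value at \<open>a\<close> is nonzero, since 0 is divisible by every
        power of \<open>p\<close>.\<close>
      unfolding vals using a by auto
    also have "multiplicity (int ?p) (w s a) \<le> 2 ^ (s - 1)"
      using a p_unit by (metis Suc_eq_plus1 multiplicity_dvd' not_less_eq_eq)
    then have "ereal (real (multiplicity (int ?p) (w s a))) \<le> ereal (real (abs_degree TYPE('a)) / 2)"
      unfolding half by (simp only: ereal_less_eq of_nat_le_iff)
    finally show ?thesis .
  qed
  have lower: "min_val TYPE('a) d \<ge> ereal (real (abs_degree TYPE('a)) / 2)"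
    if K: "real (card K) = sqrt (real CARD('a))" "degenerate_over d K" for K :: "'a set"
  proof -
    have "real CARD('a) = real (?p ^ (2 ^ (s - 1))) ^ 2"
      unfolding CARD using s1 by (metis mult.commute of_nat_power power_Suc power_mult)
    then have "card K = ?p ^ (2 ^ (s - 1))"
      using K(1) by (simp only: real_sqrt_abs abs_of_nat of_nat_eq_iff)
    then obtain j where j: "[d = ?p ^ j] (mod (?p ^ (2 ^ (s - 1)) - 1))"
      using K(2) unfolding degenerate_over_def by auto
    \<comment> \<open>The order of \<open>K\<close> is that of level \<open>s - 1\<close>, so the
      Niho divisibility applies to the last step of the tower.\<close>
    have dvd: "int ?p ^ (2 ^ (s - 1)) dvd w s x" for x
    proof (rule degenerate_rel_weil_sum_dvd[OF _ _ assms(3) j])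
      have s2: "2 * 2 ^ (s - 1) = (2::nat) ^ s"
        using s1 by (metis power_Suc)
      show "card (frob_fixed (2 * 2 ^ (s - 1)) :: 'a set) = ?p ^ (2 * 2 ^ (s - 1))"
        unfolding s2 by (rule card) simp
      show "x \<in> frob_fixed (2 * 2 ^ (s - 1))"
        unfolding s2 using frob_fixed_abs_degree[where 'a='a] assms(2) by auto
      show "rel_weil_sum (2 * 2 ^ (s - 1)) d x = of_int (w s x)"
        unfolding s2 by (rule w) (use frob_fixed_abs_degree[where 'a='a] assms(2) in auto)
    qed (rule card, simp)
    show ?thesis
      unfolding min_val_def
    proof (rule Min.boundedI)
      fix v assume "v \<in> range (\<lambda>x::'a. val ?p (weil_sum d x))"
      then obtain x :: 'a where v: "v = val ?p (weil_sum d x)"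
        by blast
      have "2 ^ (s - 1) \<le> multiplicity (int ?p) (w s x)" if "w s x \<noteq> 0"
        using dvd[of x] that p_unit by (simp add: power_dvd_iff_le_multiplicity)
      then show "ereal (real (abs_degree TYPE('a)) / 2) \<le> v"
        unfolding v vals half by (auto simp only: ereal_less_eq of_nat_le_iff split: if_splits)
    qed auto
  qed
  show ?thesis
    using upper lower by (auto intro: antisym)
qed

end
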